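(* Consider the robust freeway network control (FNC) problem over the horizon $\{0,1,\dots,T\}$, $$\mathcal C^*=\min_{\pi\in\Pi}\Big(\max_{\omega\in\Omega}\mathrm{TTS}(\pi,\omega)\Big),$$ for a network with controlled merging junctions satisfying the graph assumption, with uncertainty sets of the form described in the context (determined by upper bounds $\overline w_e(t)$ on external demand and lower bounds $\underline d_e,\underline s_e$ on demand and supply functions satisfying the fundamental diagram assumption), and with given initial state $\rho(0)$. Consider the convex optimization problem $$\begin{array}{rll}\mathcal C^{**}:=\ \min\limits_{\rho(t),\phi(t)} & \Delta t\sum_{t=0}^{T}\sum_{e\in\mathcal E} l_e\,\rho_e(t) & \\ \text{subject to} & \rho_e(t+1)=\rho_e(t)+\frac{\Delta t}{l_e}\Big(\sum_{i\in\mathcal E}\beta_{e,i}\phi_i(t)-\phi_e(t)+\overline w_e(t)\Big) & \forall e\in\mathcal E,\\ & \rho_e(t)\le \bar s_e & \forall e\in\mathcal S,\\ & 0\le\phi_e(t)\le\underline d_e(\rho_e(t)) & \forall e\in\mathcal E,\\ & \sum_{i\in\mathcal E}\beta_{e,i}\,\phi_i(t)\le\underline s_e(\rho_e(t)) & \forall e\notin\mathcal S,\\ & \rho(0)\text{ given},&\end{array}$$ with all constraints imposed for all times of the horizon. Whenever this convex problem is feasible, the two problems are equivalent in the sense that $\mathcal C^{**}=\mathcal C^*$. Moreover, if $(\rho^*(t),\phi^*(t))$ is any optimizer of the convex problem, then an optimizer of the robust FNC problem is given by the policy $$\phi_e(t):=\max\Big\{0,\ \phi_e^*(t)+\frac{p_e^\top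 L\,(\rho(t)-\rho^*(t))}{\Delta t}\Big\},\qquad e\in\mathcal N,$$ for the minimizing player (the outer minimization over $\Pi$) and the choice $\omega=\overline\omega$ for the maximizing player (the inner maximization over $\Omega$).
   Context: **Network.** $\mathcal G=(\mathcal V,\mathcal E)$ is a finite directed graph; its edges $e\in\mathcal E\subset\mathcal V\times\mathcal V$ are called cells, its vertices junctions. Traffic in cell $e$ flows from its tail $\tau_e$ to its head $\sigma_e$. With $\deg^-,\deg^+$ the in- and out-degree, let $\mathcal M=\{v:\deg^-(v)>1\}$ (merging junctions), $\mathcal S=\{e:\deg^-(\tau_e)=0\}$ (source cells), $\mathcal N=\{e:\sigma_e\in\mathcal M\}$ (cells with controlled outflow), and $\mathcal E^+(e)=\{i:\tau_i=\sigma_e\}$; a minimum over the empty set is $+\infty$. Cell $e$ has length $l_e>0$; $L=\mathrm{diag}(l_e)$; $\Delta t>0$ is the sampling time. Split ratios: $\beta_{e,i}>0$ if $\tau_e=\sigma_i$ (fraction of the outflow of cell $i$ entering cell $e$), $\beta_{e,i}=0$ otherwise, and $\sum_{i\in\mathcal E}\beta_{i,e}\le 1$ for every $e$ (the remainder leaves the network). The routing matrix $R$ has entries $R_{e,i}=\beta_{e,i}$. **Graph assumption.** $\mathcal G$ has no self loops; $\deg^+(v)=1$ for all $v\in\mathcal M$; for every edge $j$ there is a directed path (along edges with nonzero split ratios) to some edge $e$ with $\sum_{i}\beta_{i,e}<1$. **Fundamental diagram assumption** (for the functions $\underline d_e,\underline s_e$). For each cell there is a traffic jam density $\bar\rho_e$.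 The demand function $\underline d_e:[0,\bar\rho_e]\to[0,\infty)$ is concave, Lipschitz with constant $\gamma$, nondecreasing, $\underline d_e(0)=0$. The supply function $\underline s_e:[0,\bar\rho_e]\to[0,\infty)$ is concave, Lipschitz with constant $\gamma$, nonincreasing, $\underline s_e(\bar\rho_e)=0$. Moreover $\Delta t\le l_e/\gamma$ for all $e$. Cells of infinite capacity are allowed: $\bar\rho_e=+\infty$, $\underline s_e\equiv+\infty$, with $\underline d_e$ defined on $[0,\infty)$. All source cells have infinite capacity. Initial states lie in $\prod_e[0,\bar\rho_e]$ (with $[0,\infty)$ for infinite-capacity cells). **Uncertainty sets.** External demands satisfy $0\le w_e(t)\le\overline w_e(t)$, with $w_e(t)=0$ for $e\notin\mathcal S$. Realized demand functions lie in $\Omega_{d,e}=\{d_{t,e}:[0,\infty)\to[0,\infty):\ \underline d_e(\rho)\le d_{t,e}(\rho)\ \forall\rho\in[0,\bar\rho_e],\ d_{t,e}(\rho)\le\gamma\rho\ \forall\rho\}$, realized supply functions in $\Omega_{s,e}=\{s_{t,e}:[0,\infty)\to[0,\infty):\ \underline s_e(\rho)\le s_{t,e}(\rho)\ \forall\rho\in[0,\bar\rho_e]\}$ (value $+\infty$ allowed for cells of infinite capacity). Realizations may vary with $t$ and need not satisfy the fundamental diagram assumption. $\Omega$ is the set of all tuples $\omega$ of $w_e(t),d_{t,e},s_{t,e}$ over all $e\in\mathcal E$, $t\in\{0,\dots,T\}$ with these properties. $\overline\omega\in\Omega$ denotes the tuple with $w_e(t)=\overline w_e(t)$, $d_{t,e}=\underline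 d_e$, $s_{t,e}=\underline s_e$ for all $e,t$. All bounds are known a priori. **Dynamics.** For realization $\omega$, densities evolve by $\rho_e(t+1)=\rho_e(t)+\frac{\Delta t}{l_e}\big(\sum_i\beta_{e,i}\phi_i(t)-\phi_e(t)+w_e(t)\big)$. Uncontrolled flows are $\phi_e(t)=\min\{d_{t,e}(\rho_e(t)),\ \min_{i\in\mathcal E^+(e)}\frac{1}{\beta_{i,e}}s_{t,i}(\rho_i(t))\}$ for $e\notin\mathcal N$. Flows $\phi_e(t)$, $e\in\mathcal N$, are control inputs subject to $0\le\phi_e(t)\le d_{t,e}(\rho_e(t))$ for $e\in\mathcal N$ and $\sum_i\beta_{e,i}\phi_i(t)\le s_{t,e}(\rho_e(t))$ for all $e$ with $\tau_e\in\mathcal M$. In addition, ramp constraints $\rho_e(t)\le\bar s_e$, $e\in\mathcal S$, are imposed, with given constants $\bar s_e$. **Policies and cost.** A policy $\pi=(\pi_t)_{t=0}^T$ consists of maps $\pi_t:[0,\infty)^{\mathcal E}\to[0,\infty)^{\mathcal N}$, applied as $\phi_e(t)=\pi_{t,e}(\rho(t))$, $e\in\mathcal N$. $\Pi$ is the set of feasible policies: those for which the input constraints and the ramp constraints are satisfied along the closed-loop trajectory from $\rho(0)$ for every $\omega\in\Omega$. $\mathrm{TTS}(\pi,\omega)=\Delta t\sum_{t=0}^T\sum_{e}l_e\rho_e(t)$ along the closed-loop trajectory of $\pi$ under $\omega$. **Reduced routing matrix.** $\underline R_{i,j}=0$ if $j\in\mathcal N$ and $\underline R_{i,j}=R_{i,j}$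 otherwise; $P=(I-\underline R)^{-1}$ (which exists), and $p_e^\top$ is the row of $P$ corresponding to cell $e$.
   Formalization: Realized demands must also satisfy d_{t,e}(ρ) ≥ d̲_e(ρ̄_e) for densities ρ above the jam density ρ̄_e (d̲_e extended constantly); with the lower bound only on [0, ρ̄_e] an overfull cell could have zero demand forever and C* > C**. *)

theory Defs
  imports "HOL-Analysis.Analysis" "Graph_Theory.Digraph"
begin

section \<open>Problem data\<close>

text \<open>
  The cells are the arcs of a finite digraph; the type of arcs is finite and every arc of the type
  is a cell (see \<open>cell_network\<close>), so that density vectors have type \<open>real ^ 'e\<close> and the routing matrix
  has type \<open>real ^ 'e ^ 'e\<close>. The value \<open>split_ratio F e i\<close> is the fraction of the outflow of cell
  \<open>i\<close> that enters cell \<open>e\<close>. The fields \<open>demand_min\<close> and \<open>supply_min\<close> are the known lower bounds on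
  demand and supply; they are only meaningful for densities between \<open>0\<close> and \<open>jam\<close>, and
  \<open>supply_min F e\<close> is not used if \<open>jam F e = \<infinity>\<close>.
\<close>

record ('v, 'e::finite) fnc =
  topo :: "('v, 'e) pre_digraph"
  horizon :: nat
  dt :: real
  len :: "'e \<Rightarrow> real"
  split_ratio :: "'e \<Rightarrow> 'e \<Rightarrow> real"
  lip :: real
  jam :: "'e \<Rightarrow> ereal"
  demand_min :: "'e \<Rightarrow> real \<Rightarrow> real"
  supply_min :: "'e \<Rightarrow> real \<Rightarrow> real"
  inflow_max :: "nat \<Rightarrow> 'e \<Rightarrow> real"
  ramp_max :: "'e \<Rightarrow> real"
  init :: "real ^ 'e"

definition merging :: "('v, 'e::finite) fnc \<Rightarrow> 'v set" where
  "merging F = {v \<in> verts (topo F). in_degree (topo F) v > 1}"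

definition sources :: "('v, 'e::finite) fnc \<Rightarrow> 'e set" where
  "sources F = {e \<in> arcs (topo F). in_degree (topo F) (tail (topo F) e) = 0}"

definition controlled :: "('v, 'e::finite) fnc \<Rightarrow> 'e set" where
  "controlled F = {e \<in> arcs (topo F). head (topo F) e \<in> merging F}"

definition downstream :: "('v, 'e::finite) fnc \<Rightarrow> 'e \<Rightarrow> 'e set" where
  "downstream F e = {i \<in> arcs (topo F). tail (topo F) i = head (topo F) e}"

definition cell_network :: "('v, 'e::finite) fnc \<Rightarrow> bool" where
  "cell_network F \<longleftrightarrow>
     fin_digraph (topo F) \<and> nomulti_digraph (topo F) \<and> arcs (topo F) = UNIV \<and>
     dt F > 0 \<and> (\<forall>e. len F e > 0) \<and>
     (\<forall>e i. (tail (topo F) e = head (topo F) i \<longrightarrow> split_ratio F e i > 0) \<and>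
            (tail (topo F) e \<noteq> head (topo F) i \<longrightarrow> split_ratio F e i = 0)) \<and>
     (\<forall>e. (\<Sum>i\<in>UNIV. split_ratio F i e) \<le> 1)"

definition graph_assumption :: "('v, 'e::finite) fnc \<Rightarrow> bool" where
  "graph_assumption F \<longleftrightarrow>
     loopfree_digraph (topo F) \<and>
     (\<forall>v\<in>merging F. out_degree (topo F) v = 1) \<and>
     (\<forall>j. \<exists>e. (j, e) \<in> {(i, k). split_ratio F k i \<noteq> 0}\<^sup>* \<and> (\<Sum>i\<in>UNIV. split_ratio F i e) < 1)"

definition density_range :: "('v, 'e::finite) fnc \<Rightarrow> 'e \<Rightarrow> real set" where
  "density_range F e = {x. 0 \<le> x \<and> ereal x \<le> jam F e}"

definition fundamental_diagram_assumption :: "('v, 'e::finite) fnc \<Rightarrow> bool" where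
  "fundamental_diagram_assumption F \<longleftrightarrow>
     lip F > 0 \<and> (\<forall>e. dt F \<le> len F e / lip F) \<and>
     (\<forall>e. jam F e \<ge> 0) \<and>
     (\<forall>e\<in>sources F. jam F e = \<infinity>) \<and>
     (\<forall>e. demand_min F e \<in> density_range F e \<rightarrow> {0..} \<and>
          concave_on (density_range F e) (demand_min F e) \<and>
          (lip F)-lipschitz_on (density_range F e) (demand_min F e) \<and>
          mono_on (density_range F e) (demand_min F e) \<and>
          demand_min F e 0 = 0) \<and>
     (\<forall>e. jam F e \<noteq> \<infinity> \<longrightarrow>
          supply_min F e \<in> density_range F e \<rightarrow> {0..} \<and>
          concave_on (density_range F e) (supply_min F e) \<and>
          (lip F)-lipschitz_on (density_range F e) (supply_min F e) \<and>
          antimono_on (density_range F e) (supply_min F e) \<and>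
          supply_min F e (real_of_ereal (jam F e)) = 0)"

definition initial_state_ok :: "('v, 'e::finite) fnc \<Rightarrow> bool" where
  "initial_state_ok F \<longleftrightarrow> (\<forall>e. init F $ e \<in> density_range F e)"

definition inflow_bounds_ok :: "('v, 'e::finite) fnc \<Rightarrow> bool" where
  "inflow_bounds_ok F \<longleftrightarrow>
     (\<forall>t\<le>horizon F. \<forall>e. 0 \<le> inflow_max F t e \<and> (e \<notin> sources F \<longrightarrow> inflow_max F t e = 0))"

section \<open>Uncertainty\<close>

text \<open>
  Realized demand and supply functions live on all of \<open>[0, \<infinity>)\<close>, so the lower bounds have to be
  extended beyond the jam density in order to be realizations themselves. They are extended by
  their value at the jam density, which is \<open>0\<close> for the supply. Cells of infinite capacity have
  infinite supply.
\<close>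

definition clip :: "('v, 'e::finite) fnc \<Rightarrow> 'e \<Rightarrow> real \<Rightarrow> real" where
  "clip F e x = (if ereal x \<le> jam F e then x else real_of_ereal (jam F e))"

definition demand_lb :: "('v, 'e::finite) fnc \<Rightarrow> 'e \<Rightarrow> real \<Rightarrow> real" where
  "demand_lb F e x = demand_min F e (clip F e x)"

definition supply_lb :: "('v, 'e::finite) fnc \<Rightarrow> 'e \<Rightarrow> real \<Rightarrow> ereal" where
  "supply_lb F e x = (if jam F e = \<infinity> then \<infinity> else ereal (supply_min F e (clip F e x)))"

text \<open>
  Realized supplies have no upper bound, so realized densities can exceed the jam density, where a
  realized demand must still be at least the demand bound at the jam density. If the lower bound on
  the realized demand were imposed on the range between \<open>0\<close> and \<open>jam\<close> only, an overfull cell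
  could have demand \<open>0\<close> forever; then the worst case would in general not be \<open>worst_realization\<close>,
  and the robust problem would not be equivalent to the convex one.
\<close>

definition demand_set :: "('v, 'e::finite) fnc \<Rightarrow> 'e \<Rightarrow> (real \<Rightarrow> real) set" where
  "demand_set F e = {d. \<forall>x\<ge>0. 0 \<le> d x \<and> demand_lb F e x \<le> d x \<and> d x \<le> lip F * x}"

definition supply_set :: "('v, 'e::finite) fnc \<Rightarrow> 'e \<Rightarrow> (real \<Rightarrow> ereal) set" where
  "supply_set F e = {s. (\<forall>x\<ge>0. 0 \<le> s x \<and> (jam F e \<noteq> \<infinity> \<longrightarrow> s x \<noteq> \<infinity>)) \<and>
                        (\<forall>x\<in>density_range F e. supply_lb F e x \<le> s x)}"

record 'e realization =
  inflow :: "nat \<Rightarrow> 'e \<Rightarrow> real"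
  demand_fn :: "nat \<Rightarrow> 'e \<Rightarrow> real \<Rightarrow> real"
  supply_fn :: "nat \<Rightarrow> 'e \<Rightarrow> real \<Rightarrow> ereal"

definition realizations :: "('v, 'e::finite) fnc \<Rightarrow> 'e realization set" where
  "realizations F = {\<omega>. \<forall>t\<le>horizon F. \<forall>e.
      0 \<le> inflow \<omega> t e \<and> inflow \<omega> t e \<le> inflow_max F t e \<and>
      (e \<notin> sources F \<longrightarrow> inflow \<omega> t e = 0) \<and>
      demand_fn \<omega> t e \<in> demand_set F e \<and>
      supply_fn \<omega> t e \<in> supply_set F e}"

definition worst_realization :: "('v, 'e::finite) fnc \<Rightarrow> 'e realization" where
  "worst_realization F =
     \<lparr>inflow = inflow_max F, demand_fn = (\<lambda>t. demand_lb F), supply_fn = (\<lambda>t. supply_lb F)\<rparr>"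

section \<open>Closed-loop dynamics and the robust control problem\<close>

definition next_density ::
  "('v, 'e::finite) fnc \<Rightarrow> ('e \<Rightarrow> real) \<Rightarrow> real ^ 'e \<Rightarrow> real ^ 'e \<Rightarrow> real ^ 'e" where
  "next_density F w \<rho> \<phi> =
     (\<chi> e. \<rho> $ e + dt F / len F e * ((\<Sum>i\<in>UNIV. split_ratio F e i * \<phi> $ i) - \<phi> $ e + w e))"

definition travel_time :: "('v, 'e::finite) fnc \<Rightarrow> (nat \<Rightarrow> real ^ 'e) \<Rightarrow> real" where
  "travel_time F \<rho> = dt F * (\<Sum>t\<le>horizon F. \<Sum>e\<in>UNIV. len F e * \<rho> t $ e)"

text \<open>
  Only the components of a policy in \<open>controlled F\<close>, at times within the horizon and at
  nonnegative density vectors, are used.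
\<close>

type_synonym 'e policy = "nat \<Rightarrow> real ^ 'e \<Rightarrow> 'e \<Rightarrow> real"

definition flow ::
  "('v, 'e::finite) fnc \<Rightarrow> 'e policy \<Rightarrow> 'e realization \<Rightarrow> nat \<Rightarrow> real ^ 'e \<Rightarrow> real ^ 'e" where
  "flow F \<pi> \<omega> t \<rho> =
     (\<chi> e. if e \<in> controlled F then \<pi> t \<rho> e
           else real_of_ereal (min (ereal (demand_fn \<omega> t e (\<rho> $ e)))
                  (INF i\<in>downstream F e. ereal (1 / split_ratio F i e) * supply_fn \<omega> t i (\<rho> $ i))))"

primrec density ::
  "('v, 'e::finite) fnc \<Rightarrow> 'e policy \<Rightarrow> 'e realization \<Rightarrow> nat \<Rightarrow> real ^ 'e" where
  "density F \<pi> \<omega> 0 = init F"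
| "density F \<pi> \<omega> (Suc t) =
     next_density F (inflow \<omega> t) (density F \<pi> \<omega> t) (flow F \<pi> \<omega> t (density F \<pi> \<omega> t))"

definition TTS :: "('v, 'e::finite) fnc \<Rightarrow> 'e policy \<Rightarrow> 'e realization \<Rightarrow> real" where
  "TTS F \<pi> \<omega> = travel_time F (density F \<pi> \<omega>)"

definition constraints_hold ::
  "('v, 'e::finite) fnc \<Rightarrow> 'e realization \<Rightarrow> nat \<Rightarrow> real ^ 'e \<Rightarrow> real ^ 'e \<Rightarrow> bool" where
  "constraints_hold F \<omega> t \<rho> \<phi> \<longleftrightarrow>
     (\<forall>e\<in>controlled F. 0 \<le> \<phi> $ e \<and> \<phi> $ e \<le> demand_fn \<omega> t e (\<rho> $ e)) \<and>
     (\<forall>e. tail (topo F) e \<in> merging F \<longrightarrow>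
          ereal (\<Sum>i\<in>UNIV. split_ratio F e i * \<phi> $ i) \<le> supply_fn \<omega> t e (\<rho> $ e)) \<and>
     (\<forall>e\<in>sources F. \<rho> $ e \<le> ramp_max F e)"

definition feasible_policies :: "('v, 'e::finite) fnc \<Rightarrow> 'e policy set" where
  "feasible_policies F = {\<pi>.
     (\<forall>t\<le>horizon F. \<forall>\<rho>. (\<forall>e. 0 \<le> \<rho> $ e) \<longrightarrow> (\<forall>e\<in>controlled F. 0 \<le> \<pi> t \<rho> e)) \<and>
     (\<forall>\<omega>\<in>realizations F. \<forall>t\<le>horizon F.
        constraints_hold F \<omega> t (density F \<pi> \<omega> t) (flow F \<pi> \<omega> t (density F \<pi> \<omega> t)))}"

definition worst_case_cost :: "('v, 'e::finite) fnc \<Rightarrow> 'e policy \<Rightarrow> ereal" where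
  "worst_case_cost F \<pi> = (SUP \<omega>\<in>realizations F. ereal (TTS F \<pi> \<omega>))"

definition robust_value :: "('v, 'e::finite) fnc \<Rightarrow> ereal" where
  "robust_value F = (INF \<pi>\<in>feasible_policies F. worst_case_cost F \<pi>)"

section \<open>The convex problem and the induced policy\<close>

text \<open>
  The constraints force all densities up to the horizon into \<open>density_range\<close>, where \<open>demand_lb\<close> and
  \<open>supply_lb\<close> coincide with the given bounds.
\<close>

definition convex_feasible ::
  "('v, 'e::finite) fnc \<Rightarrow> ((nat \<Rightarrow> real ^ 'e) \<times> (nat \<Rightarrow> real ^ 'e)) set" where
  "convex_feasible F = {(\<rho>, \<phi>).
     \<rho> 0 = init F \<and>
     (\<forall>t\<le>horizon F.
        \<rho> (Suc t) = next_density F (inflow_max F t) (\<rho> t) (\<phi> t) \<and>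
        (\<forall>e\<in>sources F. \<rho> t $ e \<le> ramp_max F e) \<and>
        (\<forall>e. 0 \<le> \<phi> t $ e \<and> \<phi> t $ e \<le> demand_lb F e (\<rho> t $ e)) \<and>
        (\<forall>e. e \<notin> sources F \<longrightarrow>
             ereal (\<Sum>i\<in>UNIV. split_ratio F e i * \<phi> t $ i) \<le> supply_lb F e (\<rho> t $ e)))}"

definition convex_value :: "('v, 'e::finite) fnc \<Rightarrow> ereal" where
  "convex_value F = (INF (\<rho>, \<phi>)\<in>convex_feasible F. ereal (travel_time F \<rho>))"

definition convex_optimizer ::
  "('v, 'e::finite) fnc \<Rightarrow> (nat \<Rightarrow> real ^ 'e) \<Rightarrow> (nat \<Rightarrow> real ^ 'e) \<Rightarrow> bool" where
  "convex_optimizer F \<rho> \<phi> \<longleftrightarrow>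
     is_arg_min (\<lambda>(\<rho>, \<phi>). travel_time F \<rho>) (\<lambda>x. x \<in> convex_feasible F) (\<rho>, \<phi>)"

definition length_matrix :: "('v, 'e::finite) fnc \<Rightarrow> real ^ 'e ^ 'e" where
  "length_matrix F = (\<chi> i j. if i = j then len F i else 0)"

definition routing_matrix :: "('v, 'e::finite) fnc \<Rightarrow> real ^ 'e ^ 'e" where
  "routing_matrix F = (\<chi> e i. split_ratio F e i)"

definition reduced_routing_matrix :: "('v, 'e::finite) fnc \<Rightarrow> real ^ 'e ^ 'e" where
  "reduced_routing_matrix F = (\<chi> i j. if j \<in> controlled F then 0 else routing_matrix F $ i $ j)"

definition P_matrix :: "('v, 'e::finite) fnc \<Rightarrow> real ^ 'e ^ 'e" where
  "P_matrix F = matrix_inv (mat 1 - reduced_routing_matrix F)"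

definition tracking_policy ::
  "('v, 'e::finite) fnc \<Rightarrow> (nat \<Rightarrow> real ^ 'e) \<Rightarrow> (nat \<Rightarrow> real ^ 'e) \<Rightarrow> 'e policy" where
  "tracking_policy F \<rho>s \<phi>s t \<rho> e =
     max 0 (\<phi>s t $ e + (row e (P_matrix F) \<bullet> (length_matrix F *v (\<rho> - \<rho>s t))) / dt F)"

end

theory Submission
  imports Defs
begin

text \<open>
  \<^bold>\<open>Why the theorem holds.\<close> The densities of a closed loop are not ordered by their inputs: a cell may
  hold more vehicles precisely because it passes fewer on. The proof therefore replaces density by
  \<^emph>\<open>load\<close>. With \<open>Q\<close> the reduced routing matrix and \<open>P = (I - Q)\<^sup>-\<^sup>1\<close>, the load vector is \<open>P L \<rho>\<close>; the
  load of a cell consists of its own vehicles and of the share of the vehicles upstream that will reach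
  it without passing a controlled outflow. Three facts carry the proof.

  \<^item> \<open>P\<close> exists and is nonnegative. Both follow from a minimum principle for the substochastic matrix
    \<open>Q\<close>, in which every path eventually leaks (\<open>minimum_principle\<close>).
  \<^item> The load of a cell changes by its own outflow and by nonnegative multiples of controlled
    flows and external demands; other uncontrolled flows cancel (\<open>load_next_density\<close>).
  \<^item> The total travel time is a nonnegative combination of loads (\<open>travel_time_mono_load\<close>).

  Fix a feasible point of the convex problem as a reference, and let \<open>\<psi>\<^sub>e\<close> be the flow after which load
  minus outflow of \<open>e\<close> is what it is for the reference. The tracking policy is \<open>max 0 \<psi>\<^sub>e\<close>. As long as all
  loads are at most those of the reference, \<open>\<psi>\<^sub>e\<close> is at most the reference flow, and every realized flow
  is at least \<open>\<psi>\<^sub>e\<close>: for uncontrolled cells neither demand nor supply can push the flow below \<open>\<psi>\<^sub>e\<close>,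
  because the Lipschitz constants and the bound on the sampling time limit the loss in demand or
  supply by the load deficit (\<open>tracking_flow_demand\<close>, \<open>tracking_flow_supply\<close>). By induction on
  time, all loads stay at most those of the reference for every realization. Hence the tracking policy
  is feasible and its travel time never exceeds that of the reference.

  Conversely, the trajectory of any feasible policy under \<open>worst_realization\<close> is feasible for the convex
  problem (\<open>worst_trajectory_feasible\<close>), so its travel time is at least the optimal value. Tracking an
  optimizer, which exists by compactness, makes both bounds meet.
\<close>

section \<open>Routing through uncontrolled cells\<close>

locale freeway_network =
  fixes F :: "('v, 'e::finite) fnc"
  assumes cells: "cell_network F"
    and graph: "graph_assumption F"
begin

lemma dt_pos: "dt F > 0" and len_pos: "len F e > 0"
  using cells by (auto simp: cell_network_def)

lemma arcs_UNIV [simp]: "arcs (topo F) = UNIV"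
  using cells by (simp add: cell_network_def)

lemma split_pos: "tail (topo F) e = head (topo F) i \<Longrightarrow> split_ratio F e i > 0"
  using cells by (simp add: cell_network_def)

lemma split_eq_0: "tail (topo F) e \<noteq> head (topo F) i \<Longrightarrow> split_ratio F e i = 0"
  using cells by (simp add: cell_network_def)

lemma split_nonneg: "split_ratio F e i \<ge> 0"
  using split_pos[of e i] split_eq_0[of e i] by fastforce

lemma split_sum_le: "(\<Sum>i\<in>UNIV. split_ratio F i e) \<le> 1"
  using cells by (simp add: cell_network_def)

abbreviation Q :: "real ^ 'e ^ 'e" where
  "Q \<equiv> reduced_routing_matrix F"

abbreviation P :: "real ^ 'e ^ 'e" where
  "P \<equiv> P_matrix F"

lemma Q_entry: "Q $ i $ j = (if j \<in> controlled F then 0 else split_ratio F i j)"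
  by (simp add: reduced_routing_matrix_def routing_matrix_def)

lemma Q_nonneg: "Q $ i $ j \<ge> 0"
  by (simp add: Q_entry split_nonneg)

lemma Q_sum_le: "(\<Sum>i\<in>UNIV. Q $ i $ j) \<le> 1"
  using split_sum_le[of j] by (cases "j \<in> controlled F") (simp_all add: Q_entry)

text \<open>
  A minimum principle. At a cell where a negative minimum is attained, the hypothesis forces the
  split ratios to sum to \<open>1\<close> and the minimum to be attained again at every successor. Along a
  path to a cell with leakage this is a contradiction.
\<close>

lemma minimum_principle:
  fixes x :: "'e \<Rightarrow> real"
  assumes super: "\<And>j. (\<Sum>i\<in>UNIV. Q $ i $ j * x i) \<le> x j"
  shows "0 \<le> x k"
proof (rule ccontr)
  assume "\<not> 0 \<le> x k"
  define m where "m = Min (range x)"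
  have m_le: "m \<le> x i" for i
    by (simp add: m_def)
  have m_neg: "m < 0"
    using m_le[of k] \<open>\<not> 0 \<le> x k\<close> by linarith
  have "m \<in> range x"
    unfolding m_def by (rule Min_in) auto
  then obtain j where j: "x j = m"
    by auto
  have at_min: "(\<Sum>i\<in>UNIV. split_ratio F i j) = 1 \<and> (\<forall>i. split_ratio F i j \<noteq> 0 \<longrightarrow> x i = m)"
    if "x j = m" for j
  proof -
    have "(\<Sum>i\<in>UNIV. Q $ i $ j * x i) =
        m * (\<Sum>i\<in>UNIV. Q $ i $ j) + (\<Sum>i\<in>UNIV. Q $ i $ j * (x i - m))"
      unfolding sum_distrib_left sum.distrib[symmetric]
      by (intro sum.cong refl) (simp add: algebra_simps)
    then have "m * (\<Sum>i\<in>UNIV. Q $ i $ j) + (\<Sum>i\<in>UNIV. Q $ i $ j * (x i - m)) \<le> m"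
      using super[of j] that by linarith
    moreover have "(\<Sum>i\<in>UNIV. Q $ i $ j * (x i - m)) \<ge> 0"
      by (intro sum_nonneg mult_nonneg_nonneg) (auto simp: Q_nonneg m_le)
    moreover have "m \<le> m * (\<Sum>i\<in>UNIV. Q $ i $ j)"
      using mult_left_mono_neg[OF Q_sum_le[of j], of m] m_neg by simp
    ultimately have "m * (\<Sum>i\<in>UNIV. Q $ i $ j) = m"
      and sum0: "(\<Sum>i\<in>UNIV. Q $ i $ j * (x i - m)) = 0"
      by linarith+
    then have one: "(\<Sum>i\<in>UNIV. Q $ i $ j) = 1"
      using m_neg by simp
    then have "j \<notin> controlled F"
      by (auto simp: Q_entry)
    moreover have "\<forall>i. Q $ i $ j * (x i - m) = 0"
      using sum0 by (subst (asm) sum_nonneg_eq_0_iff) (auto simp: Q_nonneg m_le)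
    ultimately show ?thesis
      using one by (auto simp: Q_entry)
  qed
  obtain e where path: "(j, e) \<in> {(i, k). split_ratio F k i \<noteq> 0}\<^sup>*"
    and leak: "(\<Sum>i\<in>UNIV. split_ratio F i e) < 1"
    using graph unfolding graph_assumption_def by blast
  from path have "x e = m"
    by (induction rule: rtrancl_induct) (use j at_min in blast)+
  then show False
    using at_min[of e] leak by simp
qed

lemma reduced_entry_mult: "(mat 1 $ i $ j - Q $ i $ j) * y = (if i = j then y else 0) - Q $ i $ j * y"
  by (simp add: mat_def left_diff_distrib)

text \<open>
  A vector in the left kernel of \<open>I - Q\<close> and its negative both satisfy the minimum principle.
\<close>

lemma invertible_reduced: "invertible (mat 1 - Q)"
proof -
  have "x = 0" if "transpose (mat 1 - Q) *v x = 0" for x :: "real ^ 'e"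
  proof -
    have fixpoint: "x $ j = (\<Sum>i\<in>UNIV. Q $ i $ j * x $ i)" for j
    proof -
      have "(transpose (mat 1 - Q) *v x) $ j = x $ j - (\<Sum>i\<in>UNIV. Q $ i $ j * x $ i)"
        by (simp add: matrix_vector_mult_def transpose_def reduced_entry_mult sum_subtractf)
      then show ?thesis
        using that by (metis eq_iff_diff_eq_0 zero_index)
    qed
    have "0 \<le> x $ j" for j
      by (rule minimum_principle, rule eq_refl, rule fixpoint[symmetric])
    moreover have "0 \<le> - x $ j" for j
      by (rule minimum_principle) (simp only: mult_minus_right sum_negf fixpoint[symmetric] order_refl)
    ultimately show ?thesis
      by (simp add: vec_eq_iff order_antisym)
  qed
  then have "invertible (transpose (mat 1 - Q))"
    by (simp add: invertible_left_inverse matrix_left_invertible_ker)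
  from transpose_invertible[OF this] show ?thesis
    by simp
qed

lemma P_inverse: "(mat 1 - Q) ** P = mat 1" "P ** (mat 1 - Q) = mat 1"
  using someI_ex[OF invertible_reduced[unfolded invertible_def]]
  by (simp_all add: P_matrix_def matrix_inv_def)

text \<open>
  Row \<open>e\<close> of \<open>P\<close> satisfies \<open>p\<^sub>e (I - Q) \<ge> 0\<close>, so the minimum principle applies to it.
\<close>

lemma P_nonneg: "P $ e $ i \<ge> 0"
proof (rule minimum_principle)
  fix j
  have "(P ** (mat 1 - Q)) $ e $ j = (if e = j then 1 else 0)"
    unfolding P_inverse by (simp add: mat_def)
  moreover have "(P ** (mat 1 - Q)) $ e $ j = P $ e $ j - (\<Sum>i\<in>UNIV. Q $ i $ j * P $ e $ i)"
    by (simp add: matrix_matrix_mult_def reduced_entry_mult sum_subtractf mult.commute[of "P $ e $ _"])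
  ultimately show "(\<Sum>i\<in>UNIV. Q $ i $ j * P $ e $ i) \<le> P $ e $ j"
    by (simp split: if_splits)
qed

section \<open>The load of a cell\<close>

text \<open>
  The load of a cell consists of its own vehicles and of the share of the vehicles upstream that will
  reach it without passing a controlled outflow; a vehicle on a cycle counts once per visit.
\<close>

definition load :: "real ^ 'e \<Rightarrow> real ^ 'e" where
  "load \<rho> = P *v (length_matrix F *v \<rho>)"

lemma length_matrix_entry: "(length_matrix F *v \<rho>) $ e = len F e * \<rho> $ e"
proof -
  have "(length_matrix F *v \<rho>) $ e = (\<Sum>i\<in>UNIV. if e = i then len F e * \<rho> $ i else 0)"
    unfolding matrix_vector_mult_def length_matrix_def vec_lambda_beta by (intro sum.cong) auto
  then show ?thesis
    by simp
qed

lemma Q_fixpoint: "z $ e = ((mat 1 - Q) *v z) $ e + (\<Sum>i\<in>UNIV. Q $ e $ i * z $ i)"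
  by (simp add: matrix_vector_mult_diff_rdistrib) (simp add: matrix_vector_mult_def)

lemma load_eq: "load \<rho> $ e = len F e * \<rho> $ e + (\<Sum>i\<in>UNIV. Q $ e $ i * load \<rho> $ i)"
proof -
  have "(mat 1 - Q) *v load \<rho> = length_matrix F *v \<rho>"
    unfolding load_def matrix_vector_mul_assoc[of "mat 1 - Q"] P_inverse by simp
  then show ?thesis
    using Q_fixpoint[of "load \<rho>" e] by (metis length_matrix_entry)
qed

lemma len_next_density:
  "len F e * next_density F w \<rho> \<phi> $ e =
   len F e * \<rho> $ e + dt F * ((\<Sum>i\<in>UNIV. split_ratio F e i * \<phi> $ i) - \<phi> $ e + w e)"
proof -
  have "a * (r + d / a * x) = a * r + d * x" if "a > 0" for a r d x :: real
    using that by (simp add: distrib_left)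
  from this[OF len_pos] show ?thesis
    by (simp only: next_density_def vec_lambda_beta)
qed

text \<open>
  The coordinate change is made for this identity: \<open>P\<close> cancels the routing of the uncontrolled
  flows, so that the load of a cell changes by its own outflow and otherwise by controlled flows
  and external demand only, the latter two with nonnegative weights.
\<close>

lemma load_next_density:
  "load (next_density F w \<rho> \<phi>) $ e = load \<rho> $ e - dt F * \<phi> $ e +
     dt F * (\<Sum>i\<in>UNIV. P $ e $ i * (w i + (\<Sum>j\<in>controlled F. split_ratio F i j * \<phi> $ j)))"
proof -
  define c :: "real ^ 'e" where "c = (\<chi> i. w i + (\<Sum>j\<in>controlled F. split_ratio F i j * \<phi> $ j))"
  have "length_matrix F *v next_density F w \<rho> \<phi> =
        length_matrix F *v \<rho> + dt F *\<^sub>R (c - (mat 1 - Q) *v \<phi>)"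
  proof (subst vec_eq_iff, rule allI)
    fix i
    have "(\<Sum>j\<in>UNIV. split_ratio F i j * \<phi> $ j) =
          (\<Sum>j\<in>UNIV. (if j \<in> controlled F then split_ratio F i j * \<phi> $ j else 0) + Q $ i $ j * \<phi> $ j)"
      by (intro sum.cong) (auto simp: Q_entry)
    also have "\<dots> = (\<Sum>j\<in>controlled F. split_ratio F i j * \<phi> $ j) + (\<Sum>j\<in>UNIV. Q $ i $ j * \<phi> $ j)"
      by (simp add: sum.distrib sum.If_cases)
    finally have "(\<Sum>j\<in>UNIV. split_ratio F i j * \<phi> $ j) - \<phi> $ i + w i =
        c $ i - ((mat 1 - Q) *v \<phi>) $ i"
      using Q_fixpoint[of \<phi> i] unfolding c_def vec_lambda_beta by linarith
    then show "(length_matrix F *v next_density F w \<rho> \<phi>) $ i =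
        (length_matrix F *v \<rho> + dt F *\<^sub>R (c - (mat 1 - Q) *v \<phi>)) $ i"
      by (simp only: length_matrix_entry len_next_density vector_add_component vector_scaleR_component
          vector_minus_component real_scaleR_def)
  qed
  then have "load (next_density F w \<rho> \<phi>) = load \<rho> + dt F *\<^sub>R (P *v c - \<phi>)"
    by (simp add: load_def matrix_vector_right_distrib matrix_vector_mult_diff_distrib
        matrix_vector_mult_scaleR matrix_vector_mul_assoc P_inverse)
  then show ?thesis
    by (simp add: right_diff_distrib) (simp add: matrix_vector_mult_def c_def)
qed

text \<open>
  The number of vehicles as a combination of loads: the weight \<open>1 - (\<Sum>i. Q $ i $ e)\<close> is the share of the
  load of \<open>e\<close> that no further cell counts, and it is nonnegative.
\<close>

lemma sum_len_load: "(\<Sum>e\<in>UNIV. len F e * \<rho> $ e) = (\<Sum>e\<in>UNIV. (1 - (\<Sum>i\<in>UNIV. Q $ i $ e)) * load \<rho> $ e)"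
proof -
  have "(\<Sum>e\<in>UNIV. len F e * \<rho> $ e) =
        (\<Sum>e\<in>UNIV. load \<rho> $ e) - (\<Sum>e\<in>UNIV. \<Sum>i\<in>UNIV. Q $ e $ i * load \<rho> $ i)"
    unfolding sum_subtractf[symmetric] by (intro sum.cong refl) (metis load_eq add_diff_cancel_right')
  also have "(\<Sum>e\<in>UNIV. \<Sum>i\<in>UNIV. Q $ e $ i * load \<rho> $ i) =
        (\<Sum>i\<in>UNIV. (\<Sum>e\<in>UNIV. Q $ e $ i) * load \<rho> $ i)"
    by (subst sum.swap) (simp add: sum_distrib_right)
  finally show ?thesis
    by (simp add: left_diff_distrib sum_subtractf)
qed

lemma travel_time_mono_load:
  assumes "\<And>t e. t \<le> horizon F \<Longrightarrow> load (\<rho> t) $ e \<le> load (\<rho>' t) $ e"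
  shows "travel_time F \<rho> \<le> travel_time F \<rho>'"
  unfolding travel_time_def sum_len_load
  using assms Q_sum_le dt_pos by (intro mult_left_mono sum_mono) (auto simp: less_imp_le)

text \<open>
  The flow after which load minus outflow of a cell agrees with the reference, which is given by
  its densities \<open>\<rho>'\<close> and its flows \<open>\<phi>'\<close>.
\<close>

definition tracking_flow :: "real ^ 'e \<Rightarrow> real ^ 'e \<Rightarrow> real ^ 'e \<Rightarrow> 'e \<Rightarrow> real" where
  "tracking_flow \<rho> \<rho>' \<phi>' e = \<phi>' $ e + (load \<rho> $ e - load \<rho>' $ e) / dt F"

lemma tracking_policy_eq:
  "tracking_policy F \<rho>s \<phi>s t \<rho> e = max 0 (tracking_flow \<rho> (\<rho>s t) (\<phi>s t) e)"
proof -
  have "row e P \<bullet> (length_matrix F *v (\<rho> - \<rho>s t)) = load \<rho> $ e - load (\<rho>s t) $ e"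
    by (simp add: load_def matrix_vector_mult_diff_distrib inner_vec_def row_def
        matrix_vector_mult_def[of P] right_diff_distrib sum_subtractf)
  then show ?thesis
    by (simp add: tracking_policy_def tracking_flow_def)
qed

section \<open>Predecessors of a cell\<close>

lemma only_predecessor:
  assumes "e \<notin> controlled F" and "head (topo F) j = head (topo F) e"
  shows "j = e"
proof -
  interpret fin_digraph "topo F"
    using cells by (simp add: cell_network_def)
  have "card (in_arcs (topo F) (head (topo F) e)) \<le> 1"
    using assms(1) head_in_verts[of e] by (simp add: controlled_def merging_def in_degree_def)
  moreover have "{e, j} \<subseteq> in_arcs (topo F) (head (topo F) e)"
    using assms(2) by simp
  then have "card {e, j} \<le> card (in_arcs (topo F) (head (topo F) e))"
    by (intro card_mono) auto
  ultimately show ?thesis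
    by (auto simp: card_insert_if split: if_splits)
qed

lemma inflow_single:
  assumes "e \<notin> controlled F" and "i \<in> downstream F e"
  shows "(\<Sum>j\<in>UNIV. split_ratio F i j * z j) = split_ratio F i e * z e"
    and "(\<Sum>j\<in>UNIV. Q $ i $ j * z j) = split_ratio F i e * z e"
    and "split_ratio F i e > 0" and "i \<notin> sources F"
proof -
  have tail: "tail (topo F) i = head (topo F) e"
    using assms(2) by (simp add: downstream_def)
  have zero: "split_ratio F i j = 0" if "j \<noteq> e" for j
    using only_predecessor[OF assms(1), of j] that tail by (intro split_eq_0) auto
  have concentrated: "(\<Sum>j\<in>UNIV. a j * z j) = a e * z e" if "\<And>j. j \<noteq> e \<Longrightarrow> a j = 0" for a
    using that by (subst sum.remove[of UNIV e]) simp_all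
  show "(\<Sum>j\<in>UNIV. split_ratio F i j * z j) = split_ratio F i e * z e"
    and "(\<Sum>j\<in>UNIV. Q $ i $ j * z j) = split_ratio F i e * z e"
    using concentrated[of "\<lambda>j. split_ratio F i j"] concentrated[of "\<lambda>j. Q $ i $ j"] zero assms(1)
    by (simp_all add: Q_entry)
  show "split_ratio F i e > 0"
    using tail by (rule split_pos)
  interpret fin_digraph "topo F"
    using cells by (simp add: cell_network_def)
  have "e \<in> in_arcs (topo F) (tail (topo F) i)"
    using tail by simp
  then show "i \<notin> sources F"
    using finite_in_arcs[of "tail (topo F) i"]
    by (auto simp: sources_def in_degree_def card_eq_0_iff)
qed

lemma non_source_predecessor:
  assumes "e \<notin> sources F"
  obtains i where "e \<in> downstream F i"
proof -
  interpret fin_digraph "topo F"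
    using cells by (simp add: cell_network_def)
  have "in_arcs (topo F) (tail (topo F) e) \<noteq> {}"
    using assms by (auto simp: sources_def in_degree_def)
  then obtain i where "head (topo F) i = tail (topo F) e"
    by auto
  then show ?thesis
    by (intro that[of i]) (simp add: downstream_def)
qed

lemma source_no_inflow:
  assumes "e \<in> sources F"
  shows "split_ratio F e i = 0"
proof -
  interpret fin_digraph "topo F"
    using cells by (simp add: cell_network_def)
  have "i \<notin> in_arcs (topo F) (tail (topo F) e)"
    using assms finite_in_arcs[of "tail (topo F) e"] by (auto simp: sources_def in_degree_def)
  then show ?thesis
    by (intro split_eq_0) auto
qed

text \<open>
  Cells without uncontrolled inflow: there, comparing loads is comparing densities. This is why the
  ramp constraints and the supply constraints behind a merging junction survive the tracking.
\<close>

lemma load_boundary: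
  assumes "e \<in> sources F \<or> tail (topo F) e \<in> merging F"
  shows "load \<rho> $ e = len F e * \<rho> $ e"
proof -
  have "Q $ e $ i = 0" for i
    using assms source_no_inflow split_eq_0[of e i]
    by (cases "tail (topo F) e = head (topo F) i") (auto simp: Q_entry controlled_def)
  then show ?thesis
    by (subst load_eq) simp
qed

lemma merging_not_source: "tail (topo F) e \<in> merging F \<Longrightarrow> e \<notin> sources F"
  by (auto simp: merging_def sources_def)

end

section \<open>Demand and supply bounds\<close>

locale robust_freeway = freeway_network F
  for F :: "('v, 'e::finite) fnc" +
  assumes diagrams: "fundamental_diagram_assumption F"
    and inflow_bounds: "inflow_bounds_ok F"
    and init_ok: "initial_state_ok F"
begin

lemma lip_pos: "lip F > 0"
  and dt_le: "dt F \<le> len F e / lip F"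
  and jam_nonneg: "jam F e \<ge> 0"
  and demand_min_range: "demand_min F e \<in> density_range F e \<rightarrow> {0..}"
  and demand_min_lipschitz: "(lip F)-lipschitz_on (density_range F e) (demand_min F e)"
  and demand_min_mono: "mono_on (density_range F e) (demand_min F e)"
  and demand_min_0: "demand_min F e 0 = 0"
  using diagrams unfolding fundamental_diagram_assumption_def by blast+

lemma supply_min_range: "jam F e \<noteq> \<infinity> \<Longrightarrow> supply_min F e \<in> density_range F e \<rightarrow> {0..}"
  and supply_min_lipschitz:
    "jam F e \<noteq> \<infinity> \<Longrightarrow> (lip F)-lipschitz_on (density_range F e) (supply_min F e)"
  and supply_min_antimono: "jam F e \<noteq> \<infinity> \<Longrightarrow> antimono_on (density_range F e) (supply_min F e)"
  and supply_min_jam: "jam F e \<noteq> \<infinity> \<Longrightarrow> supply_min F e (real_of_ereal (jam F e)) = 0"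
  using diagrams unfolding fundamental_diagram_assumption_def by blast+

lemma lip_nonneg: "lip F \<ge> 0"
  using lip_pos by simp

lemma dt_lip: "dt F * lip F \<le> len F e"
  using dt_le[of e] lip_pos by (simp add: pos_le_divide_eq)

lemma clip_in_range: "0 \<le> x \<Longrightarrow> clip F e x \<in> density_range F e"
  using jam_nonneg[of e] by (cases "jam F e") (auto simp: clip_def density_range_def)

lemma clip_mono: "x \<le> y \<Longrightarrow> clip F e x \<le> clip F e y"
  and clip_diff: "x \<le> y \<Longrightarrow> clip F e y - clip F e x \<le> y - x"
  using jam_nonneg[of e] by (cases "jam F e"; auto simp: clip_def)+

lemma demand_lb_0: "demand_lb F e 0 = 0"
  using jam_nonneg[of e] by (simp add: demand_min_0 demand_lb_def clip_def flip: zero_ereal_def)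

lemma demand_lb_nonneg: "0 \<le> x \<Longrightarrow> 0 \<le> demand_lb F e x"
  using funcset_mem[OF demand_min_range clip_in_range] by (simp add: demand_lb_def)

lemma demand_lb_mono:
  assumes "0 \<le> x" and "x \<le> y"
  shows "demand_lb F e x \<le> demand_lb F e y"
  unfolding demand_lb_def using assms
  by (intro mono_onD[OF demand_min_mono] clip_in_range clip_mono) auto

lemma demand_lb_diff:
  assumes "0 \<le> x" and "x \<le> y"
  shows "demand_lb F e y - demand_lb F e x \<le> lip F * (y - x)"
proof -
  have "dist (demand_lb F e y) (demand_lb F e x) \<le> lip F * dist (clip F e y) (clip F e x)"
    unfolding demand_lb_def using assms
    by (intro lipschitz_onD[OF demand_min_lipschitz] clip_in_range) auto
  also have "\<dots> \<le> lip F * (y - x)"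
    using assms lip_nonneg clip_mono[of x y e] clip_diff[of x y e]
    by (intro mult_left_mono) (auto simp: dist_real_def)
  finally show ?thesis
    by (simp add: dist_real_def)
qed

lemma demand_lb_le: "0 \<le> x \<Longrightarrow> demand_lb F e x \<le> lip F * x"
  using demand_lb_diff[of 0 x e] by (simp add: demand_lb_0)

abbreviation finite_supply :: "'e \<Rightarrow> real \<Rightarrow> real" where
  "finite_supply e x \<equiv> supply_min F e (clip F e x)"

lemma finite_supply_nonneg:
  "jam F e \<noteq> \<infinity> \<Longrightarrow> 0 \<le> x \<Longrightarrow> 0 \<le> finite_supply e x"
  using funcset_mem[OF supply_min_range clip_in_range] by simp

lemma finite_supply_antimono:
  assumes "jam F e \<noteq> \<infinity>" and "0 \<le> x" and "x \<le> y"
  shows "finite_supply e y \<le> finite_supply e x"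
  using assms by (intro monotone_onD[OF supply_min_antimono] clip_in_range clip_mono) auto

lemma finite_supply_diff:
  assumes "jam F e \<noteq> \<infinity>" and "0 \<le> x" and "x \<le> y"
  shows "finite_supply e x - finite_supply e y \<le> lip F * (y - x)"
proof -
  have "dist (finite_supply e y) (finite_supply e x) \<le> lip F * dist (clip F e y) (clip F e x)"
    using assms by (intro lipschitz_onD[OF supply_min_lipschitz] clip_in_range) auto
  also have "\<dots> \<le> lip F * (y - x)"
    using assms lip_nonneg clip_mono[of x y e] clip_diff[of x y e]
    by (intro mult_left_mono) (auto simp: dist_real_def)
  finally show ?thesis
    by (simp add: dist_real_def)
qed

lemma supply_lb_antimono:
  "0 \<le> x \<Longrightarrow> x \<le> y \<Longrightarrow> supply_lb F e y \<le> supply_lb F e x"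
  by (simp add: supply_lb_def finite_supply_antimono)

text \<open>
  Above the jam density the bound is \<open>0\<close>, so there it is implied by the sign of a realized supply.
\<close>

lemma supply_lb_le:
  assumes "s \<in> supply_set F e" and "0 \<le> x"
  shows "supply_lb F e x \<le> s x"
proof (cases "x \<in> density_range F e")
  case True
  then show ?thesis
    using assms(1) by (simp add: supply_set_def)
next
  case False
  then have "jam F e \<noteq> \<infinity>" and "clip F e x = real_of_ereal (jam F e)"
    using assms(2) by (auto simp: density_range_def clip_def)
  then have "supply_lb F e x = 0"
    by (simp add: supply_lb_def supply_min_jam zero_ereal_def)
  then show ?thesis
    using assms by (simp add: supply_set_def)
qed

lemma worst_realization_mem: "worst_realization F \<in> realizations F"
proof -
  have "supply_lb F e \<in> supply_set F e" and "demand_lb F e \<in> demand_set F e" for e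
    by (auto simp: supply_set_def demand_set_def supply_lb_def finite_supply_nonneg
        demand_lb_nonneg demand_lb_le)
  then show ?thesis
    using inflow_bounds
    by (simp add: worst_realization_def realizations_def inflow_bounds_ok_def)
qed

section \<open>Flows and densities of a single step\<close>

text \<open>
  The minimum defining an uncontrolled flow lies between \<open>0\<close> and the finite demand, so that the
  conversion to a real number does not change it.
\<close>

lemma ereal_flow:
  assumes "\<omega> \<in> realizations F" and "t \<le> horizon F" and "\<And>e. 0 \<le> \<rho> $ e" and "e \<notin> controlled F"
  shows "ereal (flow F \<pi> \<omega> t \<rho> $ e) = min (ereal (demand_fn \<omega> t e (\<rho> $ e)))
    (INF i\<in>downstream F e. ereal (1 / split_ratio F i e) * supply_fn \<omega> t i (\<rho> $ i))"
    (is "_ = ?m")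
    and "0 \<le> flow F \<pi> \<omega> t \<rho> $ e"
proof -
  have "0 \<le> demand_fn \<omega> t e (\<rho> $ e)" and supply_ge: "\<And>i. 0 \<le> supply_fn \<omega> t i (\<rho> $ i)"
    using assms(1-3) by (auto simp: realizations_def demand_set_def supply_set_def)
  then have "0 \<le> ?m"
    by (intro min.boundedI INF_greatest mult_nonneg_nonneg) (auto simp: split_nonneg)
  moreover have "?m \<noteq> \<infinity>"
    by (auto simp: min_def)
  ultimately have "ereal (real_of_ereal ?m) = ?m"
    by (intro ereal_real') (auto elim: abs_eq_infinity_cases)
  then show "ereal (flow F \<pi> \<omega> t \<rho> $ e) = ?m"
    using assms(4) by (simp add: flow_def)
  with \<open>0 \<le> ?m\<close> show "0 \<le> flow F \<pi> \<omega> t \<rho> $ e"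
    by (metis ereal_less_eq(5))
qed

lemma flow_demand:
  assumes "\<omega> \<in> realizations F" and "t \<le> horizon F" and "\<And>e. 0 \<le> \<rho> $ e" and "e \<notin> controlled F"
  shows "flow F \<pi> \<omega> t \<rho> $ e \<le> demand_fn \<omega> t e (\<rho> $ e)"
  using ereal_flow(1)[OF assms, of \<pi>] by (metis ereal_less_eq(3) min.cobounded1)

lemma ereal_le_divide_mult:
  assumes "0 < b"
  shows "ereal x \<le> ereal (1 / b) * s \<longleftrightarrow> ereal (b * x) \<le> s"
  using assms by (cases s) (auto simp: field_simps)

lemma flow_supply:
  assumes "\<omega> \<in> realizations F" and "t \<le> horizon F" and "\<And>e. 0 \<le> \<rho> $ e" and "e \<notin> controlled F"
    and "i \<in> downstream F e"
  shows "ereal (split_ratio F i e * flow F \<pi> \<omega> t \<rho> $ e) \<le> supply_fn \<omega> t i (\<rho> $ i)"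
proof -
  have "ereal (flow F \<pi> \<omega> t \<rho> $ e) \<le> ereal (1 / split_ratio F i e) * supply_fn \<omega> t i (\<rho> $ i)"
    unfolding ereal_flow(1)[OF assms(1-4)] using assms(5) by (meson INF_lower min.coboundedI2)
  then show ?thesis
    using inflow_single(3)[OF assms(4,5)] by (simp add: ereal_le_divide_mult)
qed

lemma flow_greatest:
  assumes "\<omega> \<in> realizations F" and "t \<le> horizon F" and "\<And>e. 0 \<le> \<rho> $ e" and "e \<notin> controlled F"
    and "x \<le> demand_fn \<omega> t e (\<rho> $ e)"
    and "\<And>i. i \<in> downstream F e \<Longrightarrow> ereal (split_ratio F i e * x) \<le> supply_fn \<omega> t i (\<rho> $ i)"
  shows "x \<le> flow F \<pi> \<omega> t \<rho> $ e"
proof -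
  have "ereal x \<le> ereal (flow F \<pi> \<omega> t \<rho> $ e)"
    unfolding ereal_flow(1)[OF assms(1-4)]
    using assms(5,6) inflow_single(3)[OF assms(4)]
    by (intro min.boundedI INF_greatest) (auto simp: ereal_le_divide_mult)
  then show ?thesis
    by simp
qed

lemma next_density_nonneg:
  assumes "\<And>e. 0 \<le> \<phi> $ e" and "\<And>e. \<phi> $ e \<le> lip F * \<rho> $ e" and "\<And>e. 0 \<le> w e"
    and "\<And>e. 0 \<le> \<rho> $ e"
  shows "0 \<le> next_density F w \<rho> \<phi> $ e"
proof -
  have "dt F * \<phi> $ e \<le> dt F * lip F * \<rho> $ e"
    using assms(2)[of e] dt_pos by simp
  also have "\<dots> \<le> len F e * \<rho> $ e"
    using dt_lip assms(4) by (intro mult_right_mono) auto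
  finally have "dt F / len F e * \<phi> $ e \<le> \<rho> $ e"
    using len_pos[of e] by (simp add: field_simps)
  moreover have "0 \<le> dt F / len F e * ((\<Sum>i\<in>UNIV. split_ratio F e i * \<phi> $ i) + w e)"
    using assms(1,3) dt_pos len_pos[of e]
    by (intro mult_nonneg_nonneg add_nonneg_nonneg sum_nonneg) (auto simp: split_nonneg less_imp_le)
  ultimately show ?thesis
    unfolding next_density_def vec_lambda_beta by (simp add: algebra_simps)
qed

lemma init_nonneg: "0 \<le> init F $ e"
  using init_ok by (simp add: initial_state_ok_def density_range_def)

section \<open>Flows that track a reference of larger load\<close>

context
  fixes \<rho> \<rho>' \<phi>' :: "real ^ 'e"
  assumes nonneg: "\<And>e. 0 \<le> \<rho> $ e" "\<And>e. 0 \<le> \<rho>' $ e"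
    and below: "\<And>e. load \<rho> $ e \<le> load \<rho>' $ e"
    and ref_demand: "\<And>e. \<phi>' $ e \<le> demand_lb F e (\<rho>' $ e)"
begin

lemma tracking_flow_le: "tracking_flow \<rho> \<rho>' \<phi>' e \<le> \<phi>' $ e"
  using below[of e] dt_pos by (simp add: tracking_flow_def divide_nonpos_pos)

text \<open>
  The upstream part of the load is itself monotone in the loads, so a density deficit is paid for by at
  least the same deficit in load.
\<close>

lemma density_gap: "len F e * (\<rho>' $ e - \<rho> $ e) \<le> load \<rho>' $ e - load \<rho> $ e"
proof -
  have "(\<Sum>i\<in>UNIV. Q $ e $ i * load \<rho> $ i) \<le> (\<Sum>i\<in>UNIV. Q $ e $ i * load \<rho>' $ i)"
    by (intro sum_mono mult_left_mono below Q_nonneg)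
  then show ?thesis
    using load_eq[of \<rho> e] load_eq[of \<rho>' e] unfolding right_diff_distrib by linarith
qed

text \<open>
  If the cell holds fewer vehicles than the reference, the Lipschitz bound and the sampling
  condition make the demand drop by no more than the load deficit per time step.
\<close>

lemma tracking_flow_demand:
  assumes "d \<in> demand_set F e"
  shows "tracking_flow \<rho> \<rho>' \<phi>' e \<le> d (\<rho> $ e)"
proof -
  have d: "demand_lb F e (\<rho> $ e) \<le> d (\<rho> $ e)"
    using assms nonneg by (simp add: demand_set_def)
  show ?thesis
  proof (cases "\<rho>' $ e \<le> \<rho> $ e")
    case True
    then show ?thesis
      using d tracking_flow_le[of e] ref_demand[of e] demand_lb_mono[OF nonneg(2) True, of e] by linarith
  next
    case False
    then have "demand_lb F e (\<rho>' $ e) - demand_lb F e (\<rho> $ e) \<le> lip F * (\<rho>' $ e - \<rho> $ e)"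
      using nonneg by (intro demand_lb_diff) auto
    moreover have "dt F * (lip F * (\<rho>' $ e - \<rho> $ e)) \<le> len F e * (\<rho>' $ e - \<rho> $ e)"
      unfolding mult.assoc[symmetric] using False dt_lip by (intro mult_right_mono) auto
    then have "lip F * (\<rho>' $ e - \<rho> $ e) \<le> (load \<rho>' $ e - load \<rho> $ e) / dt F"
      using density_gap[of e] dt_pos by (simp add: pos_le_divide_eq mult.commute[of _ "dt F"])
    ultimately show ?thesis
      using d ref_demand[of e] by (simp add: tracking_flow_def diff_divide_distrib)
  qed
qed

text \<open>
  Here it is essential that an uncontrolled cell is the only cell that feeds its successor: the load
  of the successor then consists of its own content and a share of the load upstream, so that
  an excess of vehicles downstream shows up as a load deficit upstream.
\<close>

lemma tracking_flow_supply:
  assumes "e \<notin> controlled F" and "i \<in> downstream F e" and "s \<in> supply_set F i"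
    and "ereal (split_ratio F i e * \<phi>' $ e) \<le> supply_lb F i (\<rho>' $ i)"
  shows "ereal (split_ratio F i e * tracking_flow \<rho> \<rho>' \<phi>' e) \<le> s (\<rho> $ i)"
proof -
  let ?b = "split_ratio F i e"
  have s: "supply_lb F i (\<rho> $ i) \<le> s (\<rho> $ i)"
    using supply_lb_le[OF assms(3)] nonneg by simp
  have b: "?b > 0"
    by (rule inflow_single(3)[OF assms(1,2)])
  have "ereal (?b * tracking_flow \<rho> \<rho>' \<phi>' e) \<le> supply_lb F i (\<rho> $ i)"
  proof (cases "\<rho> $ i \<le> \<rho>' $ i")
    case True
    have "?b * tracking_flow \<rho> \<rho>' \<phi>' e \<le> ?b * \<phi>' $ e"
      using b tracking_flow_le by simp
    then have "ereal (?b * tracking_flow \<rho> \<rho>' \<phi>' e) \<le> ereal (?b * \<phi>' $ e)"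
      by simp
    also note assms(4)
    also have "supply_lb F i (\<rho>' $ i) \<le> supply_lb F i (\<rho> $ i)"
      using True nonneg by (intro supply_lb_antimono)
    finally show ?thesis .
  next
    case False
    show ?thesis
    proof (cases "jam F i = \<infinity>")
      case True
      then show ?thesis
        by (simp add: supply_lb_def)
    next
      case finite: False
      have ref: "?b * \<phi>' $ e \<le> finite_supply i (\<rho>' $ i)"
        using assms(4) finite by (simp add: supply_lb_def)
      have drop: "finite_supply i (\<rho>' $ i) - finite_supply i (\<rho> $ i) \<le> lip F * (\<rho> $ i - \<rho>' $ i)"
        using False nonneg finite by (intro finite_supply_diff) auto
      have "load \<rho> $ i = len F i * \<rho> $ i + ?b * load \<rho> $ e"
        and "load \<rho>' $ i = len F i * \<rho>' $ i + ?b * load \<rho>' $ e"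
        using load_eq[of \<rho> i] load_eq[of \<rho>' i] inflow_single(2)[OF assms(1,2)] by metis+
      then have "len F i * (\<rho> $ i - \<rho>' $ i) \<le> ?b * (load \<rho>' $ e - load \<rho> $ e)"
        using below[of i] unfolding right_diff_distrib by linarith
      moreover have "dt F * (lip F * (\<rho> $ i - \<rho>' $ i)) \<le> len F i * (\<rho> $ i - \<rho>' $ i)"
        unfolding mult.assoc[symmetric] using False dt_lip by (intro mult_right_mono) auto
      ultimately have "lip F * (\<rho> $ i - \<rho>' $ i) \<le> ?b * (load \<rho>' $ e - load \<rho> $ e) / dt F"
        using dt_pos by (simp add: pos_le_divide_eq mult.commute[of _ "dt F"])
      moreover have "?b * tracking_flow \<rho> \<rho>' \<phi>' e = ?b * \<phi>' $ e - ?b * (load \<rho>' $ e - load \<rho> $ e) / dt F"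
        using dt_pos by (simp add: tracking_flow_def field_simps)
      ultimately have "?b * tracking_flow \<rho> \<rho>' \<phi>' e \<le> finite_supply i (\<rho> $ i)"
        using ref drop by linarith
      then show ?thesis
        using finite by (simp add: supply_lb_def)
    qed
  qed
  from this s show ?thesis
    by (rule order_trans)
qed

end

section \<open>The tracking policy keeps all loads below the reference\<close>

lemma realizationD:
  assumes "\<omega> \<in> realizations F" and "t \<le> horizon F"
  shows "0 \<le> inflow \<omega> t e" and "inflow \<omega> t e \<le> inflow_max F t e"
    and "demand_fn \<omega> t e \<in> demand_set F e" and "supply_fn \<omega> t e \<in> supply_set F e"
  using assms unfolding realizations_def by blast+

lemma convex_feasibleD:
  assumes "(\<rho>, \<phi>) \<in> convex_feasible F"
  shows "\<rho> 0 = init F"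
    and "t \<le> horizon F \<Longrightarrow> \<rho> (Suc t) = next_density F (inflow_max F t) (\<rho> t) (\<phi> t)"
    and "t \<le> horizon F \<Longrightarrow> e \<in> sources F \<Longrightarrow> \<rho> t $ e \<le> ramp_max F e"
    and "t \<le> horizon F \<Longrightarrow> 0 \<le> \<phi> t $ e"
    and "t \<le> horizon F \<Longrightarrow> \<phi> t $ e \<le> demand_lb F e (\<rho> t $ e)"
    and "t \<le> horizon F \<Longrightarrow> e \<notin> sources F \<Longrightarrow>
         ereal (\<Sum>i\<in>UNIV. split_ratio F e i * \<phi> t $ i) \<le> supply_lb F e (\<rho> t $ e)"
  using assms unfolding convex_feasible_def by blast+

lemma inflow_max_nonneg: "t \<le> horizon F \<Longrightarrow> 0 \<le> inflow_max F t e"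
  using inflow_bounds by (simp add: inflow_bounds_ok_def)

lemma convex_density_nonneg:
  assumes "(\<rho>, \<phi>) \<in> convex_feasible F"
  shows "t \<le> Suc (horizon F) \<Longrightarrow> 0 \<le> \<rho> t $ e"
proof (induction t arbitrary: e)
  case 0
  show ?case
    by (simp add: convex_feasibleD(1)[OF assms] init_nonneg)
next
  case (Suc t)
  then have t: "t \<le> horizon F" and nonneg: "\<And>e. 0 \<le> \<rho> t $ e"
    by simp_all
  have "\<phi> t $ e \<le> lip F * \<rho> t $ e" for e
    using convex_feasibleD(5)[OF assms t] demand_lb_le[OF nonneg] by (rule order_trans)
  then show ?case
    unfolding convex_feasibleD(2)[OF assms t]
    using convex_feasibleD(4)[OF assms t] nonneg inflow_max_nonneg[OF t]
    by (intro next_density_nonneg)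
qed

text \<open>
  One step under the tracking policy. A controlled cell releases at least the tracking flow by
  definition, an uncontrolled cell because neither demand nor supply can force it below.
\<close>

lemma tracking_step:
  fixes \<rho>s \<phi>s t
  defines "\<pi> \<equiv> tracking_policy F \<rho>s \<phi>s"
  assumes ref: "(\<rho>s, \<phi>s) \<in> convex_feasible F"
    and \<omega>: "\<omega> \<in> realizations F" and t: "t \<le> horizon F"
    and nonneg: "\<And>e. 0 \<le> \<rho> $ e" and below: "\<And>e. load \<rho> $ e \<le> load (\<rho>s t) $ e"
  shows "constraints_hold F \<omega> t \<rho> (flow F \<pi> \<omega> t \<rho>)"
    and "0 \<le> next_density F (inflow \<omega> t) \<rho> (flow F \<pi> \<omega> t \<rho>) $ e"
    and "load (next_density F (inflow \<omega> t) \<rho> (flow F \<pi> \<omega> t \<rho>)) $ e \<le> load (\<rho>s (Suc t)) $ e"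
proof -
  define \<phi> where "\<phi> = flow F \<pi> \<omega> t \<rho>"
  let ?\<psi> = "tracking_flow \<rho> (\<rho>s t) (\<phi>s t)"
  note ref_nonneg = convex_density_nonneg[OF ref le_SucI[OF t]]
  note ref_demand = convex_feasibleD(5)[OF ref t]
  note \<psi>_le = tracking_flow_le[OF nonneg ref_nonneg below ref_demand]
  note \<psi>_demand = tracking_flow_demand[OF nonneg ref_nonneg below ref_demand realizationD(3)[OF \<omega> t]]
  have demand_nonneg: "0 \<le> demand_fn \<omega> t e (\<rho> $ e)"
    and demand_lip: "demand_fn \<omega> t e (\<rho> $ e) \<le> lip F * \<rho> $ e" for e
    using realizationD(3)[OF \<omega> t, of e] nonneg by (simp_all add: demand_set_def)
  have controlled: "\<phi> $ e = max 0 (?\<psi> e)" if "e \<in> controlled F" for e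
    using that by (simp add: \<phi>_def flow_def \<pi>_def tracking_policy_eq)
  have \<phi>_nonneg: "0 \<le> \<phi> $ e" for e
    using controlled ereal_flow(2)[where \<pi> = \<pi> and e = e, OF \<omega> t nonneg]
    by (cases "e \<in> controlled F") (auto simp: \<phi>_def)
  have \<phi>_demand: "\<phi> $ e \<le> demand_fn \<omega> t e (\<rho> $ e)" for e
    using controlled flow_demand[where \<pi> = \<pi> and e = e, OF \<omega> t nonneg] \<psi>_demand demand_nonneg
    by (cases "e \<in> controlled F") (auto simp: \<phi>_def)
  have \<phi>_le: "\<phi> $ e \<le> \<phi>s t $ e" if "e \<in> controlled F" for e
    using controlled[OF that] \<psi>_le convex_feasibleD(4)[OF ref t, of e] by simp
  have \<phi>_ge: "?\<psi> e \<le> \<phi> $ e" for e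
  proof (cases "e \<in> controlled F")
    case True
    then show ?thesis
      by (simp add: controlled)
  next
    case False
    show ?thesis
      unfolding \<phi>_def
    proof (rule flow_greatest[OF \<omega> t nonneg False \<psi>_demand])
      fix i
      assume i: "i \<in> downstream F e"
      have "ereal (split_ratio F i e * \<phi>s t $ e) \<le> supply_lb F i (\<rho>s t $ i)"
        using convex_feasibleD(6)[OF ref t inflow_single(4)[OF False i]]
        by (simp add: inflow_single(1)[OF False i])
      then show "ereal (split_ratio F i e * ?\<psi> e) \<le> supply_fn \<omega> t i (\<rho> $ i)"
        by (rule tracking_flow_supply[OF nonneg ref_nonneg below ref_demand False i realizationD(4)[OF \<omega> t]])
    qed
  qed
  \<comment> \<open>Where load and density are proportional, the density stays below the reference as well\<close>
  have boundary: "\<rho> $ e \<le> \<rho>s t $ e" if "e \<in> sources F \<or> tail (topo F) e \<in> merging F" for e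
    using below[of e] len_pos[of e] by (simp add: load_boundary[OF that])
  have merging: "ereal (\<Sum>i\<in>UNIV. split_ratio F e i * \<phi> $ i) \<le> supply_fn \<omega> t e (\<rho> $ e)"
    if e: "tail (topo F) e \<in> merging F" for e
  proof -
    have "split_ratio F e i * \<phi> $ i \<le> split_ratio F e i * \<phi>s t $ i" for i
    proof (cases "tail (topo F) e = head (topo F) i")
      case True
      then show ?thesis
        using e by (intro mult_left_mono \<phi>_le split_nonneg) (simp add: controlled_def)
    qed (simp add: split_eq_0)
    then have "ereal (\<Sum>i\<in>UNIV. split_ratio F e i * \<phi> $ i) \<le>
        ereal (\<Sum>i\<in>UNIV. split_ratio F e i * \<phi>s t $ i)"
      by (simp add: sum_mono)
    also have "\<dots> \<le> supply_lb F e (\<rho>s t $ e)"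
      using convex_feasibleD(6)[OF ref t merging_not_source[OF e]] .
    also have "\<dots> \<le> supply_lb F e (\<rho> $ e)"
      using nonneg boundary e by (intro supply_lb_antimono) auto
    also have "\<dots> \<le> supply_fn \<omega> t e (\<rho> $ e)"
      using realizationD(4)[OF \<omega> t] nonneg by (intro supply_lb_le)
    finally show ?thesis .
  qed
  have ramp: "\<rho> $ e \<le> ramp_max F e" if "e \<in> sources F" for e
    using boundary[of e] convex_feasibleD(3)[OF ref t that] that by simp
  show "constraints_hold F \<omega> t \<rho> (flow F \<pi> \<omega> t \<rho>)"
    unfolding constraints_hold_def \<phi>_def[symmetric]
    using \<phi>_nonneg \<phi>_demand merging ramp by blast
  show "0 \<le> next_density F (inflow \<omega> t) \<rho> (flow F \<pi> \<omega> t \<rho>) $ e"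
    unfolding \<phi>_def[symmetric]
    using \<phi>_nonneg order_trans[OF \<phi>_demand demand_lip] realizationD(1)[OF \<omega> t] nonneg
    by (intro next_density_nonneg)
  have "load \<rho> $ e - dt F * \<phi> $ e \<le> load (\<rho>s t) $ e - dt F * \<phi>s t $ e"
    using \<phi>_ge[of e] dt_pos by (simp add: tracking_flow_def field_simps)
  moreover have "(\<Sum>i\<in>UNIV. P $ e $ i * (inflow \<omega> t i + (\<Sum>j\<in>controlled F. split_ratio F i j * \<phi> $ j))) \<le>
      (\<Sum>i\<in>UNIV. P $ e $ i * (inflow_max F t i + (\<Sum>j\<in>controlled F. split_ratio F i j * \<phi>s t $ j)))"
    by (intro sum_mono mult_left_mono add_mono P_nonneg split_nonneg \<phi>_le realizationD(2)[OF \<omega> t])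
  then have "dt F * (\<Sum>i\<in>UNIV. P $ e $ i * (inflow \<omega> t i + (\<Sum>j\<in>controlled F. split_ratio F i j * \<phi> $ j))) \<le>
      dt F * (\<Sum>i\<in>UNIV. P $ e $ i * (inflow_max F t i + (\<Sum>j\<in>controlled F. split_ratio F i j * \<phi>s t $ j)))"
    using dt_pos by simp
  ultimately show "load (next_density F (inflow \<omega> t) \<rho> (flow F \<pi> \<omega> t \<rho>)) $ e \<le> load (\<rho>s (Suc t)) $ e"
    unfolding \<phi>_def[symmetric] convex_feasibleD(2)[OF ref t] load_next_density by linarith
qed

lemma tracking_invariant:
  assumes "(\<rho>s, \<phi>s) \<in> convex_feasible F" and "\<omega> \<in> realizations F"
  shows "t \<le> Suc (horizon F) \<Longrightarrow> 0 \<le> density F (tracking_policy F \<rho>s \<phi>s) \<omega> t $ e \<and>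
    load (density F (tracking_policy F \<rho>s \<phi>s) \<omega> t) $ e \<le> load (\<rho>s t) $ e"
proof (induction t arbitrary: e)
  case 0
  show ?case
    by (simp add: convex_feasibleD(1)[OF assms(1)] init_nonneg)
next
  case (Suc t)
  then show ?case
    using tracking_step(2,3)[OF assms, of t] by simp
qed

lemma tracking_feasible:
  assumes "(\<rho>s, \<phi>s) \<in> convex_feasible F"
  shows "tracking_policy F \<rho>s \<phi>s \<in> feasible_policies F"
  using tracking_step(1)[OF assms] tracking_invariant[OF assms]
  by (auto simp: feasible_policies_def tracking_policy_def)

lemma TTS_tracking_le:
  assumes "(\<rho>s, \<phi>s) \<in> convex_feasible F" and "\<omega> \<in> realizations F"
  shows "TTS F (tracking_policy F \<rho>s \<phi>s) \<omega> \<le> travel_time F \<rho>s"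
  unfolding TTS_def using tracking_invariant[OF assms] by (intro travel_time_mono_load) auto

section \<open>Worst-case trajectories are feasible for the convex problem\<close>

text \<open>
  The supply constraints of the convex problem hold behind merging junctions because the policy is
  feasible, and elsewhere because a cell that is neither a source nor behind a merging junction is fed
  by a single uncontrolled cell, whose flow already respects the supply.
\<close>

lemma worst_trajectory_feasible:
  assumes "\<pi> \<in> feasible_policies F"
  defines "\<rho> \<equiv> density F \<pi> (worst_realization F)"
  shows "(\<rho>, \<lambda>t. flow F \<pi> (worst_realization F) t (\<rho> t)) \<in> convex_feasible F"
proof -
  let ?\<omega> = "worst_realization F"
  let ?\<phi> = "\<lambda>t. flow F \<pi> ?\<omega> t (\<rho> t)"
  have constraints: "constraints_hold F ?\<omega> t (\<rho> t) (?\<phi> t)" if "t \<le> horizon F" for t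
    using assms(1) worst_realization_mem that by (auto simp: feasible_policies_def \<rho>_def)
  have fields: "inflow ?\<omega> = inflow_max F" "demand_fn ?\<omega> t = demand_lb F"
    "supply_fn ?\<omega> t = supply_lb F" for t
    by (simp_all add: worst_realization_def)
  have dynamics: "\<rho> (Suc t) = next_density F (inflow_max F t) (\<rho> t) (?\<phi> t)" for t
    by (simp add: \<rho>_def fields)
  have flow: "0 \<le> ?\<phi> t $ e \<and> ?\<phi> t $ e \<le> demand_lb F e (\<rho> t $ e)"
    if t: "t \<le> horizon F" and nonneg: "\<And>e. 0 \<le> \<rho> t $ e" for t e
  proof (cases "e \<in> controlled F")
    case True
    then show ?thesis
      using constraints[OF t] by (simp add: constraints_hold_def fields)
  next
    case False
    then show ?thesis
      using ereal_flow(2)[OF worst_realization_mem t nonneg False]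
        flow_demand[OF worst_realization_mem t nonneg False] by (simp add: fields)
  qed
  have nonneg: "t \<le> Suc (horizon F) \<Longrightarrow> 0 \<le> \<rho> t $ e" for t e
  proof (induction t arbitrary: e)
    case 0
    show ?case
      by (simp add: \<rho>_def init_nonneg)
  next
    case (Suc t)
    then have t: "t \<le> horizon F" and nonneg: "\<And>e. 0 \<le> \<rho> t $ e"
      by simp_all
    have "?\<phi> t $ e \<le> lip F * \<rho> t $ e" for e
      using flow[OF t nonneg, of e] demand_lb_le[OF nonneg, of e e] by linarith
    then show ?case
      unfolding dynamics using flow[OF t nonneg] nonneg inflow_max_nonneg[OF t]
      by (intro next_density_nonneg) blast+
  qed
  have supply_bound: "ereal (\<Sum>i\<in>UNIV. split_ratio F e i * ?\<phi> t $ i) \<le> supply_lb F e (\<rho> t $ e)"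
    if t: "t \<le> horizon F" and e: "e \<notin> sources F" for t e
  proof (cases "tail (topo F) e \<in> merging F")
    case True
    then show ?thesis
      using constraints[OF t] by (simp add: constraints_hold_def fields)
  next
    case False
    obtain i where i: "e \<in> downstream F i"
      using non_source_predecessor[OF e] .
    then have uncontrolled: "i \<notin> controlled F"
      using False by (simp add: controlled_def downstream_def)
    show ?thesis
      using flow_supply[OF worst_realization_mem t nonneg[OF le_SucI[OF t]] uncontrolled i, of \<pi>]
      by (simp only: inflow_single(1)[OF uncontrolled i] fields)
  qed
  have ramp: "\<rho> t $ e \<le> ramp_max F e" if "t \<le> horizon F" and "e \<in> sources F" for t e
    using constraints[OF that(1)] that(2) by (simp add: constraints_hold_def)
  have "\<rho> 0 = init F"
    by (simp add: \<rho>_def)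
  then show ?thesis
    unfolding convex_feasible_def
    using dynamics ramp flow[OF _ nonneg[OF le_SucI]] supply_bound by blast
qed

section \<open>Existence of an optimizer of the convex problem\<close>

lemma vehicle_balance:
  assumes "\<And>i. 0 \<le> \<phi> $ i"
  shows "(\<Sum>e\<in>UNIV. len F e * next_density F w \<rho> \<phi> $ e) \<le>
    (\<Sum>e\<in>UNIV. len F e * \<rho> $ e) + dt F * (\<Sum>e\<in>UNIV. w e)"
proof -
  let ?in = "\<lambda>e. \<Sum>i\<in>UNIV. split_ratio F e i * \<phi> $ i"
  have "(\<Sum>e\<in>UNIV. ?in e) = (\<Sum>i\<in>UNIV. (\<Sum>e\<in>UNIV. split_ratio F e i) * \<phi> $ i)"
    unfolding sum_distrib_right by (rule sum.swap)
  also have "\<dots> \<le> (\<Sum>i\<in>UNIV. \<phi> $ i)"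
  proof (rule sum_mono)
    show "(\<Sum>e\<in>UNIV. split_ratio F e i) * \<phi> $ i \<le> \<phi> $ i" for i
      using mult_right_mono[OF split_sum_le[of i] assms[of i]] by (simp only: mult_1)
  qed
  finally have "(\<Sum>e\<in>UNIV. ?in e) - (\<Sum>e\<in>UNIV. \<phi> $ e) + (\<Sum>e\<in>UNIV. w e) \<le> (\<Sum>e\<in>UNIV. w e)"
    by (simp only: diff_add_eq add_le_cancel_right le_add_same_cancel2 diff_le_0_iff_le)
  from mult_left_mono[OF this less_imp_le[OF dt_pos]]
  have "dt F * ((\<Sum>e\<in>UNIV. ?in e) - (\<Sum>e\<in>UNIV. \<phi> $ e) + (\<Sum>e\<in>UNIV. w e)) \<le> dt F * (\<Sum>e\<in>UNIV. w e)" .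
  moreover have "(\<Sum>e\<in>UNIV. len F e * next_density F w \<rho> \<phi> $ e) = (\<Sum>e\<in>UNIV. len F e * \<rho> $ e) +
     dt F * ((\<Sum>e\<in>UNIV. ?in e) - (\<Sum>e\<in>UNIV. \<phi> $ e) + (\<Sum>e\<in>UNIV. w e))"
    by (simp only: len_next_density sum.distrib sum_subtractf sum_distrib_left[symmetric])
  ultimately show ?thesis
    by (simp only: add_left_mono)
qed

text \<open>
  The density of \<open>e\<close> if all vehicles of the initial state and all external arrivals stood in \<open>e\<close>.
\<close>

definition density_bound :: "nat \<Rightarrow> 'e \<Rightarrow> real" where
  "density_bound t e =
     ((\<Sum>i\<in>UNIV. len F i * init F $ i) + dt F * (\<Sum>s<t. \<Sum>i\<in>UNIV. inflow_max F s i)) / len F e"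

lemma convex_density_le:
  assumes "(\<rho>, \<phi>) \<in> convex_feasible F" and "t \<le> Suc (horizon F)"
  shows "\<rho> t $ e \<le> density_bound t e"
proof -
  have "(\<Sum>i\<in>UNIV. len F i * \<rho> t $ i) \<le>
      (\<Sum>i\<in>UNIV. len F i * init F $ i) + dt F * (\<Sum>s<t. \<Sum>i\<in>UNIV. inflow_max F s i)"
    using assms(2)
  proof (induction t)
    case 0
    show ?case
      by (simp add: convex_feasibleD(1)[OF assms(1)])
  next
    case (Suc t)
    then have t: "t \<le> horizon F"
      by simp
    show ?case
      using vehicle_balance[OF convex_feasibleD(4)[OF assms(1) t], of "inflow_max F t" "\<rho> t"] Suc
      by (simp add: convex_feasibleD(2)[OF assms(1) t] distrib_left)
  qed
  moreover have "len F e * \<rho> t $ e \<le> (\<Sum>i\<in>UNIV. len F i * \<rho> t $ i)"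
    using convex_density_nonneg[OF assms] len_pos
    by (intro member_le_sum) (auto simp: less_imp_le)
  ultimately show ?thesis
    using len_pos[of e] by (simp add: density_bound_def pos_le_divide_eq mult.commute)
qed

end

text \<open>
  Clamping at \<open>0\<close> turns the demand and supply bounds into continuous functions on the whole line, so that
  the constraints define closed sets.
\<close>

lemma continuous_clamped:
  fixes g :: "real \<Rightarrow> real"
  assumes "\<And>x y. 0 \<le> x \<Longrightarrow> x \<le> y \<Longrightarrow> \<bar>g y - g x\<bar> \<le> C * (y - x)"
  shows "continuous_on UNIV (\<lambda>x. g (max 0 x))"
proof -
  have "C-lipschitz_on {0..} g"
  proof (rule lipschitz_on_leI)
    show "dist (g x) (g y) \<le> C * dist x y" if "x \<in> {0..}" "x \<le> y" for x y
      using assms[of x y] that by (simp add: dist_real_def abs_minus_commute[of "g x"])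
    show "0 \<le> C"
      using assms[of 0 1] by simp
  qed
  then have "continuous_on {0..} g"
    by (rule lipschitz_on_continuous_on)
  then show ?thesis
    by (rule continuous_on_compose2) (auto intro!: continuous_intros)
qed

text \<open>Tychonoff, for the product topology of the function type.\<close>

lemma compact_box_sequences:
  fixes B :: "nat \<Rightarrow> (real ^ 'e::finite) set"
  assumes "\<And>t. compact (B t)"
  shows "compact {\<rho>. \<forall>t. \<rho> t \<in> B t}"
proof -
  have "compactin (product_topology (\<lambda>_. euclidean) UNIV) (PiE UNIV B)"
    using assms by (simp add: compactin_PiE)
  moreover have "PiE UNIV B = {\<rho>. \<forall>t. \<rho> t \<in> B t}"
    by (auto simp: PiE_def Pi_def)
  ultimately show ?thesis
    by (simp add: euclidean_product_topology)
qed

context robust_freeway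
begin

text \<open>
  Only finitely many entries of a feasible pair of sequences are constrained. Setting the others
  to \<open>0\<close> yields a compact set of sequences on which the same travel times are attained.
\<close>

lemma convex_optimizer_exists:
  assumes "convex_feasible F \<noteq> {}"
  shows "\<exists>\<rho> \<phi>. convex_optimizer F \<rho> \<phi>"
proof -
  let ?T = "horizon F"
  \<comment> \<open>Compact boxes for densities and flows, collapsed to \<open>0\<close> beyond the last constrained time\<close>
  define BR :: "nat \<Rightarrow> (real ^ 'e) set" where
    "BR t = (if t \<le> Suc ?T then cbox 0 (\<chi> e. density_bound t e) else {0})" for t
  define BF :: "nat \<Rightarrow> (real ^ 'e) set" where
    "BF t = (if t \<le> ?T then cbox 0 (\<chi> e. lip F * density_bound t e) else {0})" for t
  \<comment> \<open>The convex constraints, with clamped bounds, as conditions that are evidently closed\<close>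
  define D where "D e x = demand_lb F e (max 0 x)" for e x
  define S where "S e x = finite_supply e (max 0 x)" for e x
  let ?inflow = "\<lambda>(\<phi> :: real ^ 'e) e. \<Sum>i\<in>UNIV. split_ratio F e i * \<phi> $ i"
  define start where "start = {x :: (nat \<Rightarrow> real ^ 'e) \<times> (nat \<Rightarrow> real ^ 'e). fst x 0 = init F}"
  define dynamics where "dynamics t = {x :: (nat \<Rightarrow> real ^ 'e) \<times> (nat \<Rightarrow> real ^ 'e).
    fst x (Suc t) = next_density F (inflow_max F t) (fst x t) (snd x t)}" for t
  define ramp where "ramp t e = {x :: (nat \<Rightarrow> real ^ 'e) \<times> (nat \<Rightarrow> real ^ 'e).
    fst x t $ e \<le> ramp_max F e}" for t e
  define sign where "sign t e = {x :: (nat \<Rightarrow> real ^ 'e) \<times> (nat \<Rightarrow> real ^ 'e).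
    0 \<le> snd x t $ e}" for t e
  define demanded where "demanded t e = {x :: (nat \<Rightarrow> real ^ 'e) \<times> (nat \<Rightarrow> real ^ 'e).
    snd x t $ e \<le> D e (fst x t $ e)}" for t e
  define supplied where "supplied t e = {x :: (nat \<Rightarrow> real ^ 'e) \<times> (nat \<Rightarrow> real ^ 'e).
    ?inflow (snd x t) e \<le> S e (fst x t $ e)}" for t e
  define Z where "Z = start \<inter> (\<Inter>t\<in>{..?T}. dynamics t \<inter> (\<Inter>e\<in>sources F. ramp t e) \<inter>
    (\<Inter>e. sign t e \<inter> demanded t e) \<inter> (\<Inter>e\<in>{e. e \<notin> sources F \<and> jam F e \<noteq> \<infinity>}. supplied t e))"
  define K where "K = ({\<rho>. \<forall>t. \<rho> t \<in> BR t} \<times> {\<phi>. \<forall>t. \<phi> t \<in> BF t}) \<inter> Z"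

  have cont_fst: "continuous_on UNIV (\<lambda>x :: (nat \<Rightarrow> real ^ 'e) \<times> (nat \<Rightarrow> real ^ 'e). fst x t)" for t
    by (rule continuous_on_product_then_coordinatewise[OF continuous_on_fst[OF continuous_on_id]])
  have cont_snd: "continuous_on UNIV (\<lambda>x :: (nat \<Rightarrow> real ^ 'e) \<times> (nat \<Rightarrow> real ^ 'e). snd x t)" for t
    by (rule continuous_on_product_then_coordinatewise[OF continuous_on_snd[OF continuous_on_id]])
  note cont_entry = continuous_on_component[OF cont_fst] continuous_on_component[OF cont_snd]
  have cont_D: "continuous_on UNIV (D e)" for e
    unfolding D_def
  proof (rule continuous_clamped)
    show "\<bar>demand_lb F e y - demand_lb F e x\<bar> \<le> lip F * (y - x)" if "0 \<le> x" "x \<le> y" for x y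
      using demand_lb_mono[OF that, of e] demand_lb_diff[OF that, of e] by simp
  qed
  have cont_S: "continuous_on UNIV (S e)" if e: "jam F e \<noteq> \<infinity>" for e
    unfolding S_def
  proof (rule continuous_clamped)
    show "\<bar>finite_supply e y - finite_supply e x\<bar> \<le> lip F * (y - x)" if "0 \<le> x" "x \<le> y" for x y
      using finite_supply_antimono[OF e that] finite_supply_diff[OF e that] by simp
  qed
  have "closed start"
    unfolding start_def by (intro closed_Collect_eq cont_fst continuous_on_const)
  moreover have "closed (dynamics t)" for t
    unfolding dynamics_def next_density_def
    by (intro closed_Collect_eq cont_fst cont_entry continuous_on_vec_lambda continuous_on_add
        continuous_on_diff continuous_on_mult continuous_on_sum continuous_on_const)
  moreover have "closed (ramp t e)" for t e
    unfolding ramp_def by (intro closed_Collect_le cont_entry continuous_on_const)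
  moreover have "closed (sign t e)" for t e
    unfolding sign_def by (intro closed_Collect_le cont_entry continuous_on_const)
  moreover have "closed (demanded t e)" for t e
    unfolding demanded_def
    by (intro closed_Collect_le cont_entry continuous_on_compose2[OF cont_D]) simp
  moreover have "closed (supplied t e)" if "jam F e \<noteq> \<infinity>" for t e
    unfolding supplied_def
    by (intro closed_Collect_le cont_entry continuous_on_compose2[OF cont_S[OF that]]
        continuous_on_sum continuous_on_mult continuous_on_const) simp
  ultimately have "closed Z"
    unfolding Z_def by (intro closed_Int closed_INT ballI) simp_all
  moreover have "compact (BR t)" and "compact (BF t)" for t
    by (simp_all add: BR_def BF_def)
  ultimately have "compact K"
    unfolding K_def by (intro compact_Int_closed compact_Times compact_box_sequences)

  have Z_iff: "(\<rho>, \<phi>) \<in> Z \<longleftrightarrow> (\<rho>, \<phi>) \<in> convex_feasible F"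
    if nonneg: "\<And>t e. t \<le> Suc ?T \<Longrightarrow> 0 \<le> \<rho> t $ e" for \<rho> \<phi>
  proof -
    have "D e (\<rho> t $ e) = demand_lb F e (\<rho> t $ e)" and "S e (\<rho> t $ e) = finite_supply e (\<rho> t $ e)"
      if "t \<le> ?T" for t e
      using nonneg[of t e] that by (simp_all add: D_def S_def max_absorb2)
    then show ?thesis
      by (simp add: Z_def start_def dynamics_def ramp_def sign_def demanded_def supplied_def
          convex_feasible_def supply_lb_def) blast
  qed
  have K_feasible: "(\<rho>, \<phi>) \<in> convex_feasible F" if "(\<rho>, \<phi>) \<in> K" for \<rho> \<phi>
  proof -
    have "0 \<le> \<rho> t $ e" if "t \<le> Suc ?T" for t e
    proof -
      have "\<rho> t \<in> BR t"
        using \<open>(\<rho>, \<phi>) \<in> K\<close> by (simp add: K_def)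
      then show ?thesis
        using that by (simp add: BR_def mem_box_cart)
    qed
    then show ?thesis
      using Z_iff that by (simp add: K_def)
  qed
  have truncate: "\<exists>\<rho>' \<phi>'. (\<rho>', \<phi>') \<in> K \<and> travel_time F \<rho>' = travel_time F \<rho>"
    if feas: "(\<rho>, \<phi>) \<in> convex_feasible F" for \<rho> \<phi>
  proof (intro exI conjI)
    let ?\<rho> = "\<lambda>t. if t \<le> Suc ?T then \<rho> t else 0"
    let ?\<phi> = "\<lambda>t. if t \<le> ?T then \<phi> t else 0"
    note nonneg = convex_density_nonneg[OF feas]
    have BR: "?\<rho> t \<in> BR t" for t
      using nonneg convex_density_le[OF feas] by (simp add: BR_def mem_box_cart)
    have "\<phi> t $ e \<le> lip F * density_bound t e" if t: "t \<le> ?T" for t e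
    proof -
      have "\<phi> t $ e \<le> lip F * \<rho> t $ e"
        using convex_feasibleD(5)[OF feas t] demand_lb_le[OF nonneg[OF le_SucI[OF t]]]
        by (rule order_trans)
      also have "\<dots> \<le> lip F * density_bound t e"
        using convex_density_le[OF feas le_SucI[OF t]] lip_nonneg by (rule mult_left_mono)
      finally show ?thesis .
    qed
    then have BF: "?\<phi> t \<in> BF t" for t
      using convex_feasibleD(4)[OF feas] by (simp add: BF_def mem_box_cart)
    have "(?\<rho>, ?\<phi>) \<in> convex_feasible F"
      using feas by (simp add: convex_feasible_def)
    then have "(?\<rho>, ?\<phi>) \<in> Z"
      using nonneg by (subst Z_iff) simp_all
    with BR BF show "(?\<rho>, ?\<phi>) \<in> K"
      by (simp add: K_def)
    show "travel_time F ?\<rho> = travel_time F \<rho>"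
      by (simp add: travel_time_def)
  qed

  have "K \<noteq> {}"
    using assms truncate by fast
  moreover have "continuous_on UNIV (\<lambda>x :: (nat \<Rightarrow> real ^ 'e) \<times> (nat \<Rightarrow> real ^ 'e). travel_time F (fst x))"
    unfolding travel_time_def
    by (intro continuous_on_mult continuous_on_sum continuous_on_const cont_entry)
  then have "continuous_on K (\<lambda>x. travel_time F (fst x))"
    by (rule continuous_on_subset) simp
  ultimately obtain x where x: "x \<in> K" "\<And>y. y \<in> K \<Longrightarrow> travel_time F (fst x) \<le> travel_time F (fst y)"
    using continuous_attains_inf[OF \<open>compact K\<close>] by blast
  obtain \<rho>s \<phi>s where xs: "x = (\<rho>s, \<phi>s)"
    by (cases x)
  have "travel_time F \<rho>s \<le> travel_time F \<rho>" if feas: "(\<rho>, \<phi>) \<in> convex_feasible F" for \<rho> \<phi>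
  proof -
    obtain \<rho>' \<phi>' where "(\<rho>', \<phi>') \<in> K" and "travel_time F \<rho>' = travel_time F \<rho>"
      using truncate[OF feas] by blast
    then show ?thesis
      using x(2)[of "(\<rho>', \<phi>')"] by (simp add: xs)
  qed
  moreover have "(\<rho>s, \<phi>s) \<in> convex_feasible F"
    using K_feasible x(1) by (simp only: xs)
  ultimately have "convex_optimizer F \<rho>s \<phi>s"
    by (auto simp: convex_optimizer_def is_arg_min_linorder)
  then show ?thesis
    by blast
qed

section \<open>The two problems have the same value\<close>

lemma convex_optimizerD:
  assumes "convex_optimizer F \<rho>s \<phi>s"
  shows "(\<rho>s, \<phi>s) \<in> convex_feasible F"
    and "(\<rho>, \<phi>) \<in> convex_feasible F \<Longrightarrow> travel_time F \<rho>s \<le> travel_time F \<rho>"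
  using assms by (auto simp: convex_optimizer_def is_arg_min_linorder)

lemma TTS_worst_ge:
  assumes "convex_optimizer F \<rho>s \<phi>s" and "\<pi> \<in> feasible_policies F"
  shows "travel_time F \<rho>s \<le> TTS F \<pi> (worst_realization F)"
  unfolding TTS_def
  by (rule convex_optimizerD(2)[OF assms(1) worst_trajectory_feasible[OF assms(2)]])

lemma worst_case_cost_ge:
  assumes "convex_optimizer F \<rho>s \<phi>s" and "\<pi> \<in> feasible_policies F"
  shows "ereal (travel_time F \<rho>s) \<le> worst_case_cost F \<pi>"
  unfolding worst_case_cost_def
  using TTS_worst_ge[OF assms] worst_realization_mem by (intro SUP_upper2) auto

lemma worst_case_cost_tracking:
  assumes "convex_optimizer F \<rho>s \<phi>s"
  shows "worst_case_cost F (tracking_policy F \<rho>s \<phi>s) = ereal (travel_time F \<rho>s)"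
proof (rule antisym)
  note feas = convex_optimizerD(1)[OF assms]
  show "worst_case_cost F (tracking_policy F \<rho>s \<phi>s) \<le> ereal (travel_time F \<rho>s)"
    unfolding worst_case_cost_def using TTS_tracking_le[OF feas] by (intro SUP_least) simp
  show "ereal (travel_time F \<rho>s) \<le> worst_case_cost F (tracking_policy F \<rho>s \<phi>s)"
    by (rule worst_case_cost_ge[OF assms tracking_feasible[OF feas]])
qed

end

theorem theorem1:
  fixes F :: "('v, 'e::finite) fnc"
  assumes "cell_network F"
    and "graph_assumption F"
    and "fundamental_diagram_assumption F"
    and "inflow_bounds_ok F"
    and "initial_state_ok F"
    and "convex_feasible F \<noteq> {}"
  shows "(\<exists>\<rho>s \<phi>s. convex_optimizer F \<rho>s \<phi>s) \<and>
         convex_value F = robust_value F \<and>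
         (\<forall>\<rho>s \<phi>s. convex_optimizer F \<rho>s \<phi>s \<longrightarrow>
            is_arg_min (worst_case_cost F) (\<lambda>\<pi>. \<pi> \<in> feasible_policies F)
              (tracking_policy F \<rho>s \<phi>s) \<and>
            is_arg_max (TTS F (tracking_policy F \<rho>s \<phi>s)) (\<lambda>\<omega>. \<omega> \<in> realizations F)
              (worst_realization F))"
proof -
  interpret robust_freeway F
    using assms by unfold_locales
  obtain \<rho> \<phi> where opt: "convex_optimizer F \<rho> \<phi>"
    using convex_optimizer_exists[OF assms(6)] by blast
  have "convex_value F = ereal (travel_time F \<rho>)"
    unfolding convex_value_def using convex_optimizerD[OF opt]
    by (intro antisym INF_lower2[where i = "(\<rho>, \<phi>)"] INF_greatest) auto
  moreover have "robust_value F = ereal (travel_time F \<rho>)"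
    unfolding robust_value_def
    using worst_case_cost_ge[OF opt] worst_case_cost_tracking[OF opt]
      tracking_feasible[OF convex_optimizerD(1)[OF opt]]
    by (intro antisym INF_greatest INF_lower2[where i = "tracking_policy F \<rho> \<phi>"]) auto
  moreover have "is_arg_min (worst_case_cost F) (\<lambda>\<pi>. \<pi> \<in> feasible_policies F) (tracking_policy F \<rho>s \<phi>s)"
    and "is_arg_max (TTS F (tracking_policy F \<rho>s \<phi>s)) (\<lambda>\<omega>. \<omega> \<in> realizations F) (worst_realization F)"
    if "convex_optimizer F \<rho>s \<phi>s" for \<rho>s \<phi>s
  proof -
    note feas = tracking_feasible[OF convex_optimizerD(1)[OF that]]
    show "is_arg_min (worst_case_cost F) (\<lambda>\<pi>. \<pi> \<in> feasible_policies F) (tracking_policy F \<rho>s \<phi>s)"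
      using feas worst_case_cost_tracking[OF that] worst_case_cost_ge[OF that]
      by (simp add: is_arg_min_linorder)
    show "is_arg_max (TTS F (tracking_policy F \<rho>s \<phi>s)) (\<lambda>\<omega>. \<omega> \<in> realizations F) (worst_realization F)"
      using worst_realization_mem TTS_tracking_le[OF convex_optimizerD(1)[OF that]]
        TTS_worst_ge[OF that feas] by (force simp: is_arg_max_linorder)
  qed
  ultimately show ?thesis
    using opt by auto
qed

end
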